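(* Let $n\ge 2$, $1\le d\le n-1$, and let $w$ be a weight such that $c_w^2\le W_k\le C_w^2$ for all $k\in\mathbb{Z}^n$, for some uniform constants $c_w,C_w>0$. Let $f\in\mathcal{T}'$, $s\in\mathbb{R}$, and $s(p,n):=n\left|\frac{p-2}{2p}\right|$. (i) If $1<p\le2$, then $$\|f\|_{L_s^p(\mathbb{T}^n)}\le C_1\|R_df\|_{L_s^{2,2}(X_{d,n};w)}\le C_2\|R_df\|_{L_{s+s(p,n)}^{p,2}(X_{d,n};w)},$$ where $C_1,C_2>0$ do not depend on $f$. If $p=1$, then the first inequality holds. (ii) If $2\le p<\infty$, then $$\|f\|_{L_s^p(\mathbb{T}^n)}\le C_1\|R_df\|_{L_{s+s(p,n)}^{2,2}(X_{d,n};w)}\le C_2\|R_df\|_{L_{s+s(p,n)}^{p,2}(X_{d,n};w)},$$ where $C_1,C_2>0$ do not depend on $f$.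
   Context: Let $\mathbb{T}^n=\mathbb{R}^n/\mathbb{Z}^n$ (with Lebesgue measure of total mass 1), $\mathcal{T}=C^\infty(\mathbb{T}^n)$, and let $\mathcal{T}'$ be its dual, the space of periodic distributions, with duality pairing $(\cdot,\cdot)$ (so $(f,g)=\int_{\mathbb{T}^n}fg$ for functions). Fourier coefficients are $\hat f(k)=(f,e^{-2\pi i k\cdot x})$, $k\in\mathbb{Z}^n$. $\mathbf{Gr}(d,n)$ is the set of all $d$-dimensional linear subspaces of $\mathbb{Q}^n$; $k\perp A$ means $k\cdot v=0$ for all $v\in A$. Radon transform: for $f\in\mathcal{T}$ and linearly independent $v_1,\dots,v_d\in\mathbb{Z}^n$, with $A=\{v_1,\dots,v_d\}$, $R_df(x,A)=\int_{[0,1]^d}f(x+t_1v_1+\cdots+t_dv_d)\,dt_1\cdots dt_d$. For $f\in\mathcal{T}'$, $R_df(\cdot,A)\in\mathcal{T}'$ is defined by $(R_df(\cdot,A),g)=(f,R_dg(\cdot,A))$ for all $g\in\mathcal{T}$. This depends only on the subspace of $\mathbb{Q}^n$ spanned by $A$, so $R_df(\cdot,A)$ is regarded as defined for $A\in\mathbf{Gr}(d,n)$. For $\omega:\mathbb{Z}^n\to\mathbb{R}$, $F_\omega$ is the Fourier multiplier $\widehat{F_\omega f}(k)=\omega(k)\hat f(k)$. Write $\langle k\rangle=(1+|k|^2)^{1/2}$; $(1-\Delta)^{s/2}$ denotes the Fourier multiplier $\langle k\rangle^s$. For $p\in[1,\infty]$, $s\in\mathbb{R}$: $\|f\|_{L_s^p(\mathbb{T}^n)}=\|(1-\Delta)^{s/2}f\|_{L^p(\mathbb{T}^n)}$.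 Weights: a weight is a function $w:\mathbb{Z}^n\times\mathbf{Gr}(d,n)\to(0,\infty)$ such that for each fixed $A$ there exist $C,N>0$ (possibly depending on $A$) with $w(k,A)\ge C\langle k\rangle^{-N}$ for all $k\in\mathbb{Z}^n$. Set $\Omega_k=\{A\in\mathbf{Gr}(d,n):k\perp A\}$ and $W_k=\sum_{A\in\Omega_k}w(k,A)^2$. Data spaces: $X_{d,n}=\mathbb{T}^n\times\mathbf{Gr}(d,n)$. For a family $g=\{g(\cdot,A)\}_{A\in\mathbf{Gr}(d,n)}$ with $g(\cdot,A)\in\mathcal{T}'$, $\|g\|_{L_s^{p,2}(X_{d,n};w)}^2=\sum_{A\in\mathbf{Gr}(d,n)}\|F_{w(\cdot,A)}g(\cdot,A)\|_{L_s^p(\mathbb{T}^n)}^2$. All norms take the value $+\infty$ when the element does not belong to the corresponding space. *)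

theory Defs
  imports "HOL-Analysis.Analysis"
begin

section \<open>Test functions and periodic distributions on the torus\<close>

text \<open>
  The dimension is CARD('n): the types real ^ 'n, int ^ 'n and rat ^ 'n
  play the roles of $R^n$, $Z^n$ and $Q^n$. Functions on the torus $R^n / Z^n$ are represented
  by $Z^n$-periodic functions on real ^ 'n, and integration over the torus by integration
  over the unit cube.
\<close>

definition real_vec :: "int ^ 'n \<Rightarrow> real ^ 'n" where
  "real_vec k = (\<chi> i. of_int (k $ i))"

definition rat_vec :: "int ^ 'n \<Rightarrow> rat ^ 'n" where
  "rat_vec k = (\<chi> i. of_int (k $ i))"

definition torus :: "(real ^ 'n) measure" where
  "torus = restrict_space lborel (cbox 0 1)"

definition partial :: "'n \<Rightarrow> (real ^ 'n \<Rightarrow> complex) \<Rightarrow> real ^ 'n \<Rightarrow> complex" where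
  "partial i g x = frechet_derivative g (at x) (axis i 1)"

definition partials :: "'n list \<Rightarrow> (real ^ 'n \<Rightarrow> complex) \<Rightarrow> real ^ 'n \<Rightarrow> complex" where
  "partials = foldr partial"

text \<open>
  Smoothness: all iterated partial derivatives exist and are (Frechet) differentiable.
\<close>

definition test_functions :: "(real ^ 'n \<Rightarrow> complex) set" where
  "test_functions = {g.
     (\<forall>k x. g (x + real_vec k) = g x) \<and>
     (\<forall>js x. partials js g differentiable (at x))}"

text \<open>
  The suprema below are over bounded sets for every test function, and the family of seminorms
  indexed by N generates the usual Frechet topology of the space of test functions.
\<close>

definition seminorm_C :: "nat \<Rightarrow> (real ^ 'n \<Rightarrow> complex) \<Rightarrow> real" where
  "seminorm_C N g = (\<Sum>js\<in>{js. length js \<le> N}. SUP x. cmod (partials js g x))"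

text \<open>
  A distribution is a functional on all functions of which only the values at test
  functions are relevant.
\<close>

definition distributions :: "((real ^ 'n \<Rightarrow> complex) \<Rightarrow> complex) set" where
  "distributions = {u.
     (\<forall>g\<in>test_functions. \<forall>h\<in>test_functions. u (\<lambda>x. g x + h x) = u g + u h) \<and>
     (\<forall>c. \<forall>g\<in>test_functions. u (\<lambda>x. c * g x) = c * u g) \<and>
     (\<exists>C N. \<forall>g\<in>test_functions. cmod (u g) \<le> C * seminorm_C N g)}"

definition dist_of_fun :: "(real ^ 'n \<Rightarrow> complex) \<Rightarrow> (real ^ 'n \<Rightarrow> complex) \<Rightarrow> complex" where
  "dist_of_fun h g = (LINT x|torus. h x * g x)"


section \<open>Fourier coefficients and multipliers\<close>

definition character :: "int ^ 'n \<Rightarrow> real ^ 'n \<Rightarrow> complex" where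
  "character k x = cis (2 * pi * (real_vec k \<bullet> x))"

definition fourier :: "((real ^ 'n \<Rightarrow> complex) \<Rightarrow> complex) \<Rightarrow> int ^ 'n \<Rightarrow> complex" where
  "fourier u k = u (character (- k))"

text \<open>
  The multiplier with symbol \<omega> applied to u is the Fourier series with coefficients
  $\omega(k) \hat u(k)$, paired with a test function g whose Fourier series is
  $\sum_k \hat g(k) e_k$. It has the defining property \<open>fourier_multiplier\<close> below. If
  \<omega> grows too fast for it to be a distribution, then it has Fourier coefficients that
  are not polynomially bounded, and so it is not represented by any integrable function.
\<close>

definition multiplier ::
  "(int ^ 'n \<Rightarrow> real) \<Rightarrow> ((real ^ 'n \<Rightarrow> complex) \<Rightarrow> complex) \<Rightarrow> (real ^ 'n \<Rightarrow> complex) \<Rightarrow> complex"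
where
  "multiplier \<omega> u g = (\<Sum>\<^sub>\<infinity>k. of_real (\<omega> k) * fourier u k * fourier (dist_of_fun g) (- k))"

lemma integral_cis_unit_interval:
  fixes m :: int
  shows "(LINT t|lborel. indicator {0..1} t *\<^sub>R cis (2 * pi * of_int m * t)) = (if m = 0 then 1 else 0)"
proof (cases "m = 0")
  case True
  then show ?thesis by simp
next
  case False
  define F where "F t = cis (2 * pi * of_int m * t) / (2 * pi * of_int m * \<i>)" for t :: real
  have "(F has_vector_derivative cis (2 * pi * of_int m * t)) (at t within {0..1})" for t
  proof -
    define a where "a = 2 * complex_of_real pi * of_int m * \<i>"
    have "a \<noteq> 0" using False by (simp add: a_def)
    then have "((\<lambda>z. exp (a * z) / a) has_field_derivative exp (a * of_real t)) (at (of_real t))"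
      by (auto intro!: derivative_eq_intros)
    from has_vector_derivative_real_field[OF this, of "{0..1}"] show ?thesis
      by (simp add: F_def[abs_def] cis_conv_exp a_def mult_ac)
  qed
  then have "(LINT t|lborel. indicator {0..1} t *\<^sub>R cis (2 * pi * of_int m * t)) = F 1 - F 0"
    by (intro integral_FTC_Icc) (auto intro!: continuous_intros)
  also have "F 1 = F 0"
    using cis_multiple_2pi[of "of_int m"] by (simp add: F_def)
  finally show ?thesis using False by simp
qed

lemma integral_character:
  fixes k :: "int ^ 'n"
  shows "(LINT x|torus. character k x) = (if k = 0 then 1 else 0)"
proof -
  interpret product_sigma_finite "\<lambda>_ :: real ^ 'n. lborel :: real measure" ..
  let ?G = "\<lambda>(b :: real ^ 'n) (t :: real).
    indicator {0..1} t *\<^sub>R cis (2 * pi * of_int \<lfloor>real_vec k \<bullet> b\<rfloor> * t)"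
  have fl: "of_int \<lfloor>real_vec k \<bullet> b\<rfloor> = real_vec k \<bullet> b" if "b \<in> Basis" for b
    using that by (auto simp: Basis_vec_def inner_axis real_vec_def)
  have one: "1 \<bullet> b = (1 :: real)" if "b \<in> Basis" for b :: "real ^ 'n"
    using that by (auto simp: Basis_vec_def inner_axis one_vec_def)
  have G: "indicator (cbox 0 1) x *\<^sub>R character k x = (\<Prod>b\<in>Basis. ?G b (x \<bullet> b))" for x :: "real ^ 'n"
  proof -
    have *: "indicator (cbox 0 1) x = (\<Prod>b\<in>Basis. indicator {0..1} (x \<bullet> b) :: real)"
      by (auto simp: indicator_def mem_box one prod_zero_iff)
    have "character k x = cis (\<Sum>b\<in>Basis. 2 * pi * of_int \<lfloor>real_vec k \<bullet> b\<rfloor> * (x \<bullet> b))"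
      unfolding character_def
      by (subst euclidean_inner[of "real_vec k" x])
        (auto simp: fl sum_distrib_left intro!: arg_cong[where f = cis] sum.cong)
    also have "\<dots> = (\<Prod>b\<in>Basis. cis (2 * pi * of_int \<lfloor>real_vec k \<bullet> b\<rfloor> * (x \<bullet> b)))"
      by (simp add: cis_conv_exp exp_sum sum_distrib_left)
    finally show ?thesis
      by (simp add: * scaleR_conv_of_real prod.distrib)
  qed
  have "(LINT x|torus. character k x) = (LINT x|lborel. (\<Prod>b\<in>Basis. ?G b (x \<bullet> b)))"
    unfolding torus_def by (subst integral_restrict_space) (simp_all add: G)
  also have "\<dots> = (LINT f|(\<Pi>\<^sub>M b\<in>Basis. lborel). (\<Prod>b\<in>Basis. ?G b ((\<Sum>c\<in>Basis. f c *\<^sub>R c) \<bullet> b)))"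
    by (subst lborel_eq) (rule integral_distr, simp_all add: cis_conv_exp)
  also have "\<dots> = (LINT f|(\<Pi>\<^sub>M b\<in>Basis. lborel). (\<Prod>b\<in>Basis. ?G b (f b)))"
    by (simp cong: prod.cong)
  also have "\<dots> = (\<Prod>b\<in>Basis. (LINT t|lborel. ?G b t))"
    by (intro product_integral_prod)
      (auto intro!: borel_integrable_atLeastAtMost' continuous_intros
        simp flip: set_integrable_def)
  also have "\<dots> = (\<Prod>b\<in>(Basis :: (real ^ 'n) set). if \<lfloor>real_vec k \<bullet> b\<rfloor> = 0 then 1 else 0)"
    by (simp only: integral_cis_unit_interval)
  also have "\<dots> = (if k = 0 then 1 else 0)"
    by (auto simp: Basis_vec_def inner_axis real_vec_def vec_eq_iff prod_zero_iff intro!: prod.neutral)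
  finally show ?thesis .
qed

lemma fourier_multiplier:
  fixes k :: "int ^ 'n"
  shows "fourier (multiplier \<omega> u) k = of_real (\<omega> k) * fourier u k"
proof -
  have "character l x * character m x = character (l + m) x" for l m and x :: "real ^ 'n"
    by (simp add: character_def cis_mult real_vec_def inner_vec_def algebra_simps sum.distrib)
  then have *: "fourier (dist_of_fun (character (- k))) (- l) = (if l = k then 1 else 0)" for l
    by (simp add: fourier_def dist_of_fun_def integral_character)
  show ?thesis
    unfolding fourier_def[of "multiplier \<omega> u"] multiplier_def *
    by (subst infsum_cong_neutral[where T = "{k}"]) auto
qed

definition bracket :: "int ^ 'n \<Rightarrow> real" where
  "bracket k = sqrt (1 + (norm (real_vec k))\<^sup>2)"


section \<open>Norms\<close>

text \<open>
  All norms are extended nonnegative reals, with the value top outside of the space.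
\<close>

definition ennreal_powr :: "ennreal \<Rightarrow> real \<Rightarrow> ennreal" where
  "ennreal_powr x a = (if x = top then top else ennreal (enn2real x powr a))"

definition Lp_norm_fun :: "real \<Rightarrow> (real ^ 'n \<Rightarrow> complex) \<Rightarrow> ennreal" where
  "Lp_norm_fun p h = ennreal_powr (\<integral>\<^sup>+ x. ennreal (cmod (h x) powr p) \<partial>torus) (1 / p)"

text \<open>
  The L^p norm of a distribution, for finite p: the infimum is over the integrable functions
  representing u, which are unique almost everywhere, and it is top if there are none.
\<close>

definition Lp_norm :: "real \<Rightarrow> ((real ^ 'n \<Rightarrow> complex) \<Rightarrow> complex) \<Rightarrow> ennreal" where
  "Lp_norm p u = (INF h \<in> {h. integrable torus h \<and> (\<forall>g\<in>test_functions. u g = dist_of_fun h g)}.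
     Lp_norm_fun p h)"

definition sobolev_norm :: "real \<Rightarrow> real \<Rightarrow> ((real ^ 'n \<Rightarrow> complex) \<Rightarrow> complex) \<Rightarrow> ennreal" where
  "sobolev_norm p s u = Lp_norm p (multiplier (\<lambda>k. bracket k powr s) u)"


section \<open>The Radon transform\<close>

definition Gr :: "nat \<Rightarrow> (rat ^ 'n) set set" where
  "Gr d = {A. vec.subspace A \<and> vec.dim A = d}"

definition perp :: "int ^ 'n \<Rightarrow> (rat ^ 'n) set \<Rightarrow> bool" where
  "perp k A \<longleftrightarrow> (\<forall>v\<in>A. (\<Sum>i\<in>UNIV. of_int (k $ i) * v $ i) = 0)"

definition integer_basis :: "nat \<Rightarrow> (nat \<Rightarrow> int ^ 'n) \<Rightarrow> (rat ^ 'n) set \<Rightarrow> bool" where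
  "integer_basis d v A \<longleftrightarrow>
     inj_on v {..<d} \<and>
     vec.independent ((\<lambda>i. rat_vec (v i)) ` {..<d}) \<and>
     vec.span ((\<lambda>i. rat_vec (v i)) ` {..<d}) = A"

definition radon_fun ::
  "nat \<Rightarrow> (nat \<Rightarrow> int ^ 'n) \<Rightarrow> (real ^ 'n \<Rightarrow> complex) \<Rightarrow> real ^ 'n \<Rightarrow> complex"
where
  "radon_fun d v g x =
     (LINT t|(\<Pi>\<^sub>M i\<in>{..<d}. restrict_space lborel {0..1::real}). g (x + (\<Sum>i<d. t i *\<^sub>R real_vec (v i))))"

definition radon_vectors ::
  "nat \<Rightarrow> ((real ^ 'n \<Rightarrow> complex) \<Rightarrow> complex) \<Rightarrow> (nat \<Rightarrow> int ^ 'n) \<Rightarrow> (real ^ 'n \<Rightarrow> complex) \<Rightarrow> complex"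
where
  "radon_vectors d f v g = f (radon_fun d v g)"

text \<open>
  The transform depends only on the rational span of the vectors, so that any integer basis
  of the subspace may be used; there is one by \<open>integer_basis_exists\<close>.
\<close>

definition radon ::
  "nat \<Rightarrow> ((real ^ 'n \<Rightarrow> complex) \<Rightarrow> complex) \<Rightarrow> (rat ^ 'n) set \<Rightarrow> (real ^ 'n \<Rightarrow> complex) \<Rightarrow> complex"
where
  "radon d f A = radon_vectors d f (SOME v. integer_basis d v A)"

lemma clear_denominators:
  fixes x :: "rat ^ 'n"
  shows "\<exists>(c :: rat) k. c \<noteq> 0 \<and> rat_vec k = c *s x"
proof -
  have "\<forall>i. \<exists>a b. b > 0 \<and> x $ i = of_int a / of_int b"
    by (metis quotient_of_unique quotient_of_div quotient_of_denom_pos surj_pair)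
  then obtain a b where ab: "\<And>i. b i > 0" "\<And>i. x $ i = of_int (a i) / of_int (b i)"
    by metis
  define c where "c = (\<Prod>i\<in>UNIV. b i)"
  have "rat_vec (\<chi> i. a i * (\<Prod>j\<in>UNIV - {i}. b j)) = of_int c *s x"
  proof (subst vec_eq_iff, intro allI)
    fix i
    have "c = b i * (\<Prod>j\<in>UNIV - {i}. b j)"
      unfolding c_def by (rule prod.remove) auto
    then show "rat_vec (\<chi> i. a i * (\<Prod>j\<in>UNIV - {i}. b j)) $ i = (of_int c *s x) $ i"
      using ab(1)[of i] by (simp add: rat_vec_def ab(2))
  qed
  moreover have "(of_int c :: rat) \<noteq> 0"
    using ab(1) by (auto simp: c_def prod_zero_iff) (metis less_irrefl)
  ultimately show ?thesis by blast
qed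

lemma integer_basis_exists:
  fixes A :: "(rat ^ 'n) set"
  assumes "A \<in> Gr d"
  shows "\<exists>v. integer_basis d v A"
proof -
  have A: "vec.subspace A" "vec.dim A = d"
    using assms by (auto simp: Gr_def)
  obtain B where B: "B \<subseteq> A" "vec.independent B" "A \<subseteq> vec.span B" "card B = d"
    using vec.basis_exists[of A] A(2) by metis
  have fin: "finite B" using B(2) vec.independent_bound_general by blast
  obtain e where e: "bij_betw e {..<d} B"
    using ex_bij_betw_nat_finite[OF fin] B(4) by (auto simp: atLeast0LessThan)
  obtain c :: "rat ^ 'n \<Rightarrow> rat" and k where ck: "\<And>x. c x \<noteq> 0" "\<And>x. rat_vec (k x) = c x *s x"
    using clear_denominators by metis
  have im: "(\<lambda>i. rat_vec (k (e i))) ` {..<d} = (\<lambda>x. c x *s x) ` B"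
    using e by (auto simp: ck bij_betw_def image_image)
  define S where "S = (\<lambda>i. rat_vec (k (e i))) ` {..<d}"
  have span: "vec.span S = A"
    unfolding S_def im using vec.span_image_scale[OF fin, of c] ck(1) B(1,3) A(1)
    by (metis vec.span_subspace)
  have "vec.dim S = d"
    using span A(2) by (metis vec.dim_span)
  moreover have "vec.dim S \<le> card S"
    by (rule vec.dim_le_card') (simp add: S_def)
  moreover have "card S \<le> d"
    unfolding S_def using card_image_le[of "{..<d}"] by fastforce
  ultimately have card: "card S = d" by simp
  have "S \<subseteq> A" "finite S"
    using vec.span_superset[of S] span by (simp_all add: S_def)
  then have ind: "vec.independent S"
    using vec.card_le_dim_spanning[of S A] span A card by simp
  have "inj_on (\<lambda>i. rat_vec (k (e i))) {..<d}"
    using card by (auto simp: S_def intro: eq_card_imp_inj_on)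
  then have "inj_on (\<lambda>i. k (e i)) {..<d}"
    by (auto simp: inj_on_def)
  then show ?thesis
    using ind span by (auto simp: integer_basis_def S_def intro!: exI[of _ "\<lambda>i. k (e i)"])
qed


section \<open>Weights and data spaces\<close>

definition is_weight :: "nat \<Rightarrow> (int ^ 'n \<Rightarrow> (rat ^ 'n) set \<Rightarrow> real) \<Rightarrow> bool" where
  "is_weight d w \<longleftrightarrow>
     (\<forall>k. \<forall>A\<in>Gr d. 0 < w k A) \<and>
     (\<forall>A\<in>Gr d. \<exists>C>0. \<exists>N>0. \<forall>k. C * bracket k powr (- N) \<le> w k A)"

definition weight_sum :: "nat \<Rightarrow> (int ^ 'n \<Rightarrow> (rat ^ 'n) set \<Rightarrow> real) \<Rightarrow> int ^ 'n \<Rightarrow> ennreal" where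
  "weight_sum d w k = (\<Sum>\<^sub>\<infinity>A\<in>{A \<in> Gr d. perp k A}. ennreal ((w k A)\<^sup>2))"

definition data_norm ::
  "nat \<Rightarrow> (int ^ 'n \<Rightarrow> (rat ^ 'n) set \<Rightarrow> real) \<Rightarrow> real \<Rightarrow> real \<Rightarrow>
    ((rat ^ 'n) set \<Rightarrow> (real ^ 'n \<Rightarrow> complex) \<Rightarrow> complex) \<Rightarrow> ennreal"
where
  "data_norm d w p s G =
     ennreal_powr (\<Sum>\<^sub>\<infinity>A\<in>Gr d. (sobolev_norm p s (multiplier (\<lambda>k. w k A) (G A)))\<^sup>2) (1 / 2)"

definition sobolev_exponent :: "'n itself \<Rightarrow> real \<Rightarrow> real" where
  "sobolev_exponent _ p = real CARD('n) * \<bar>(p - 2) / (2 * p)\<bar>"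

end

theory Submission
  imports Defs
begin

text \<open>
  The Fourier coefficients of the Radon transform along \<open>A\<close> are those of \<open>f\<close> at the
  frequencies orthogonal to \<open>A\<close> and zero elsewhere. By Parseval and Tonelli the square of
  the norm of the data in the case \<open>p = 2\<close> is therefore $\sum_k W_k \langle k\rangle^{2s}
  |\hat f(k)|^2$, which is comparable to the square of the $L^2_s$ norm of \<open>f\<close>.
  The inequalities between different \<open>p\<close> are the inclusions of the $L^p$ spaces on a
  probability space and, at the critical exponent, the Sobolev embedding of $L^2_\sigma$ into
  $L^q$, $\sigma = n (1/2 - 1/q)$, applied to \<open>f\<close> itself (\<open>p \<ge> 2\<close>) or in its dual form
  to every \<open>A\<close> separately (\<open>p \<le> 2\<close>).

  The embedding is proved for trigonometric polynomials by the level set method of Chemin and Xu: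
  at height \<open>t\<close> the polynomial is split at the frequency below which its low part is
  at most \<open>t / 2\<close> everywhere, so that only the $L^2$ norm of the high part enters the measure of
  the level set. Riesz--Fischer and Fatou carry it over to general coefficients.
\<close>

section \<open>Trigonometric polynomials\<close>

lemma space_torus [simp]: "space torus = cbox 0 1"
  by (simp add: torus_def)

lemma one_inner_Basis: "b \<in> Basis \<Longrightarrow> (1 :: real ^ 'n) \<bullet> b = 1"
  by (auto simp: Basis_vec_def inner_axis one_vec_def)

lemma emeasure_space_torus: "emeasure (torus :: (real ^ 'n) measure) (cbox 0 1) = 1"
  unfolding torus_def
  by (simp add: emeasure_restrict_space emeasure_lborel_cbox_eq one_inner_Basis)

lemma finite_measure_torus: "finite_measure (torus :: (real ^ 'n) measure)"
  by (rule finite_measureI) (simp add: emeasure_space_torus)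

lemma continuous_imp_measurable_torus:
  "continuous_on UNIV f \<Longrightarrow> f \<in> borel_measurable torus" for f :: "real ^ 'n \<Rightarrow> 'a::topological_space"
  unfolding torus_def
  by (intro measurable_restrict_space1) (simp add: borel_measurable_continuous_onI)

lemma continuous_imp_integrable_torus:
  fixes f :: "real ^ 'n \<Rightarrow> complex"
  assumes "continuous_on UNIV f"
  shows "integrable torus f"
proof -
  interpret finite_measure "torus :: (real ^ 'n) measure" by (rule finite_measure_torus)
  have "compact (f ` cbox 0 1)"
    by (intro compact_continuous_image continuous_on_subset[OF assms]) auto
  then obtain B where "\<And>x. x \<in> cbox 0 1 \<Longrightarrow> norm (f x) \<le> B"
    by (auto simp: compact_eq_bounded_closed bounded_iff)
  then show ?thesis
    by (intro integrable_const_bound[where B = B] continuous_imp_measurable_torus assms) auto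
qed

lemma real_vec_uminus: "real_vec (- k) = - real_vec k"
  and real_vec_add: "real_vec (k + l) = real_vec k + real_vec l"
  by (simp_all add: real_vec_def vec_eq_iff)

lemma character_mult: "character k x * character l x = character (k + l) x"
  by (simp add: character_def cis_mult real_vec_add inner_add_left algebra_simps)

lemma cnj_character: "cnj (character k x) = character (- k) x"
  by (simp add: character_def cis_cnj real_vec_uminus)

lemma cmod_character [simp]: "cmod (character k x) = 1"
  by (simp add: character_def)

lemma continuous_on_character [continuous_intros]: "continuous_on A (character k)"
  unfolding character_def cis_conv_exp by (intro continuous_intros)

lemma measurable_character [measurable]: "character k \<in> borel_measurable torus"
  by (intro continuous_imp_measurable_torus continuous_intros)

definition trig :: "(int ^ 'n) set \<Rightarrow> (int ^ 'n \<Rightarrow> complex) \<Rightarrow> real ^ 'n \<Rightarrow> complex" where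
  "trig F c x = (\<Sum>k\<in>F. c k * character k x)"

lemma continuous_on_trig [continuous_intros]: "continuous_on A (trig F c)"
  unfolding trig_def by (intro continuous_intros)

lemma measurable_trig [measurable]: "trig F c \<in> borel_measurable torus"
  by (intro continuous_imp_measurable_torus continuous_intros)

lemma cnj_trig: "cnj (trig F c x) = (\<Sum>k\<in>F. cnj (c k) * character (- k) x)"
  by (simp add: trig_def cnj_character)

section \<open>Pairings with trigonometric polynomials and Parseval's identity\<close>

lemma integrable_mult_bounded_torus:
  fixes h g :: "real ^ 'n \<Rightarrow> complex"
  assumes "integrable torus h" "continuous_on UNIV g"
  shows "integrable torus (\<lambda>x. h x * g x)"
proof -
  have "compact (g ` cbox 0 1)"
    by (intro compact_continuous_image continuous_on_subset[OF assms(2)]) auto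
  then obtain B where "\<And>x. x \<in> cbox 0 1 \<Longrightarrow> norm (g x) \<le> B"
    by (auto simp: compact_eq_bounded_closed bounded_iff)
  then have "norm (h x * g x) \<le> norm (B *\<^sub>R h x)" if "x \<in> cbox 0 1" for x
    using mult_left_mono[of "norm (g x)" "\<bar>B\<bar>" "norm (h x)"] that
    by (simp add: norm_mult mult.commute) (meson abs_ge_self order_trans)
  moreover have "(\<lambda>x. h x * g x) \<in> borel_measurable torus"
    using assms(1) continuous_imp_measurable_torus[OF assms(2)] by measurable
  ultimately show ?thesis
    by (intro Bochner_Integration.integrable_bound[OF integrable_scaleR_right[OF assms(1), of B]] AE_I2)
      simp_all
qed

text \<open>The pairing is bilinear, without conjugation, so the frequency \<open>k\<close> of the
  polynomial meets the coefficient of \<open>h\<close> at \<open>- k\<close>.\<close>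

lemma integral_mult_trig:
  assumes "integrable torus h"
  shows "(LINT x|torus. h x * trig F c x) = (\<Sum>k\<in>F. c k * fourier (dist_of_fun h) (- k))"
proof -
  have "(LINT x|torus. h x * trig F c x) = (LINT x|torus. (\<Sum>k\<in>F. c k * (h x * character k x)))"
    by (simp add: trig_def sum_distrib_left mult_ac)
  also have "\<dots> = (\<Sum>k\<in>F. LINT x|torus. c k * (h x * character k x))"
    by (intro Bochner_Integration.integral_sum integrable_mult_right
        integrable_mult_bounded_torus assms continuous_intros)
  finally show ?thesis
    by (simp add: fourier_def dist_of_fun_def)
qed

text \<open>Conjugating the polynomial makes the pairing Hermitian, so that equal frequencies meet.
  This is the form behind both Parseval's identity and the duality argument.\<close>

lemma integral_mult_cnj_trig:
  assumes "integrable torus h"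
  shows "(LINT x|torus. h x * cnj (trig F c x)) = (\<Sum>k\<in>F. cnj (c k) * fourier (dist_of_fun h) k)"
proof -
  have "(LINT x|torus. h x * cnj (trig F c x)) = (LINT x|torus. (\<Sum>k\<in>F. cnj (c k) * (h x * character (- k) x)))"
    by (simp add: cnj_trig sum_distrib_left mult_ac)
  also have "\<dots> = (\<Sum>k\<in>F. LINT x|torus. cnj (c k) * (h x * character (- k) x))"
    by (intro Bochner_Integration.integral_sum integrable_mult_right
        integrable_mult_bounded_torus assms continuous_intros)
  finally show ?thesis
    by (simp add: fourier_def dist_of_fun_def)
qed

lemma fourier_trig:
  assumes "finite F"
  shows "fourier (dist_of_fun (trig F c)) k = (if k \<in> F then c k else 0)"
proof -
  have "fourier (dist_of_fun (trig F c)) k = (LINT x|torus. character (- k) x * trig F c x)"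
    by (simp add: fourier_def dist_of_fun_def mult.commute)
  also have "\<dots> = (\<Sum>l\<in>F. c l * fourier (dist_of_fun (character (- k))) (- l))"
    by (intro integral_mult_trig continuous_imp_integrable_torus continuous_intros)
  also have "\<dots> = (\<Sum>l\<in>F. if l = k then c l else 0)"
    by (intro sum.cong)
      (auto simp: fourier_def dist_of_fun_def character_mult integral_character)
  finally show ?thesis using assms by simp
qed

text \<open>Parseval's identity: the polynomial is paired with its own conjugate, and orthogonality
  of the characters leaves only the diagonal terms.\<close>

lemma nn_integral_cmod_trig_square:
  assumes "finite F"
  shows "(\<integral>\<^sup>+ x. ennreal ((cmod (trig F c x))\<^sup>2) \<partial>torus) = ennreal (\<Sum>k\<in>F. (cmod (c k))\<^sup>2)"
proof -
  have int: "integrable torus (\<lambda>x. trig F c x * cnj (trig F c x))"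
    by (intro continuous_imp_integrable_torus continuous_intros)
  have sq: "of_real ((cmod (trig F c x))\<^sup>2) = trig F c x * cnj (trig F c x)" for x
    by (simp flip: of_real_power add: complex_norm_square)
  have "(LINT x|torus. complex_of_real ((cmod (trig F c x))\<^sup>2)) = (\<Sum>k\<in>F. cnj (c k) * c k)"
    unfolding sq by (subst integral_mult_cnj_trig)
      (auto intro!: sum.cong continuous_imp_integrable_torus continuous_intros simp: fourier_trig assms)
  also have "\<dots> = of_real (\<Sum>k\<in>F. (cmod (c k))\<^sup>2)"
    by (simp add: complex_norm_square mult.commute del: of_real_power)
  finally have *: "(LINT x|torus. (cmod (trig F c x))\<^sup>2) = (\<Sum>k\<in>F. (cmod (c k))\<^sup>2)"
    by (simp only: integral_complex_of_real of_real_eq_iff)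
  have "integrable torus (\<lambda>x. complex_of_real ((cmod (trig F c x))\<^sup>2))"
    using int by (simp only: sq)
  then have "integrable torus (\<lambda>x. (cmod (trig F c x))\<^sup>2)"
    by (simp only: complex_of_real_integrable_eq)
  then show ?thesis
    by (subst nn_integral_eq_integral) (simp_all add: *)
qed

section \<open>The Sobolev embedding for trigonometric polynomials\<close>

lemma bracket_ge_1: "1 \<le> bracket k"
  by (simp add: bracket_def)

lemma bracket_pos [simp]: "0 < bracket k"
  using bracket_ge_1[of k] by linarith

lemma abs_component_le_bracket: "real_of_int \<bar>k $ i\<bar> \<le> bracket k"
proof -
  have "real_of_int \<bar>k $ i\<bar> \<le> norm (real_vec k)"
    using component_le_norm_cart[of "real_vec k" i] by (simp add: real_vec_def)
  also have "\<dots> \<le> bracket k"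
    unfolding bracket_def by (rule real_le_rsqrt) simp
  finally show ?thesis .
qed

text \<open>Induction on \<open>N\<close>. The step is the weighted mean inequality N^(1-\<beta>)
  (N+1)^\<beta> \<le> (1-\<beta>) N + \<beta> (N+1) = N + \<beta>, divided by (N+1)^\<beta>.\<close>

lemma sum_powr_le:
  assumes "0 \<le> \<beta>" "\<beta> < 1"
  shows "(\<Sum>m=1..N. real m powr - \<beta>) \<le> real N powr (1 - \<beta>) / (1 - \<beta>)"
proof (induction N)
  case 0
  then show ?case by simp
next
  case (Suc N)
  have "real N powr (1 - \<beta>) \<le> (real N + \<beta>) * real (Suc N) powr - \<beta>"
  proof (cases "N = 0")
    case False
    then have "real N powr (1 - \<beta>) * real (Suc N) powr \<beta> \<le> (1 - \<beta>) * real N + \<beta> * real (Suc N)"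
      using assms by (intro Youngs_inequality_0) auto
    then show ?thesis
      by (simp add: powr_minus field_simps)
  qed (use assms in simp)
  also have "\<dots> = real (Suc N) powr (1 - \<beta>) - (1 - \<beta>) * real (Suc N) powr - \<beta>"
    by (simp add: powr_diff powr_minus field_simps)
  finally have "(real N powr (1 - \<beta>) + (1 - \<beta>) * real (Suc N) powr - \<beta>) / (1 - \<beta>)
      \<le> real (Suc N) powr (1 - \<beta>) / (1 - \<beta>)"
    using assms by (intro divide_right_mono) auto
  then show ?case
    using Suc.IH assms by (simp add: add_divide_distrib)
qed

text \<open>The positive and the negative integers each contribute a sum bounded by
  \<open>sum_powr_le\<close>. Zero contributes 1, which is at most A^(1-\<beta>) / (1-\<beta>)
  because \<open>A\<close> is at least 1; hence the factor 3.\<close>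

lemma sum_int_powr_le:
  assumes "0 \<le> \<beta>" "\<beta> < 1" "1 \<le> A"
  shows "(\<Sum>m\<in>{m. real_of_int \<bar>m\<bar> \<le> A}. max 1 (real_of_int \<bar>m\<bar>) powr - \<beta>) \<le> 3 / (1 - \<beta>) * A powr (1 - \<beta>)"
proof -
  define N where "N = nat \<lfloor>A\<rfloor>"
  let ?b = "\<lambda>m. max 1 (real_of_int \<bar>m\<bar>) powr - \<beta>"
  have N: "real N \<le> A" using assms(3) by (simp add: N_def)
  have eq: "{m. real_of_int \<bar>m\<bar> \<le> A} = insert 0 (int ` {1..N} \<union> (\<lambda>m. - int m) ` {1..N})"
  proof (intro set_eqI iffI)
    fix m assume "m \<in> {m. real_of_int \<bar>m\<bar> \<le> A}"
    then have "nat \<bar>m\<bar> \<le> N"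
      unfolding N_def by (intro nat_mono) (simp add: le_floor_iff)
    then have "m = 0 \<or> nat \<bar>m\<bar> \<in> {1..N}"
      by auto
    moreover have "m = int (nat \<bar>m\<bar>) \<or> m = - int (nat \<bar>m\<bar>)"
      by linarith
    ultimately show "m \<in> insert 0 (int ` {1..N} \<union> (\<lambda>m. - int m) ` {1..N})"
      by blast
  qed (use N assms(3) in auto)
  have S: "(\<Sum>m\<in>int ` {1..N}. ?b m) = (\<Sum>m=1..N. real m powr - \<beta>)"
    by (subst sum.reindex) (auto intro!: sum.cong simp: max_def inj_on_def)
  have S': "(\<Sum>m\<in>(\<lambda>m. - int m) ` {1..N}. ?b m) = (\<Sum>m=1..N. real m powr - \<beta>)"
    by (subst sum.reindex) (auto intro!: sum.cong simp: max_def inj_on_def)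
  have "(\<Sum>m\<in>{m. real_of_int \<bar>m\<bar> \<le> A}. ?b m) = 1 + 2 * (\<Sum>m=1..N. real m powr - \<beta>)"
    unfolding eq by (subst sum.insert, (auto)[2], subst sum.union_disjoint, (auto)[3]) (simp only: S S', simp)
  also have "\<dots> \<le> A powr (1 - \<beta>) / (1 - \<beta>) + 2 * (A powr (1 - \<beta>) / (1 - \<beta>))"
  proof (intro add_mono mult_left_mono order_trans[OF sum_powr_le])
    have "1 - \<beta> \<le> A powr (1 - \<beta>)"
      using ge_one_powr_ge_zero[of A "1 - \<beta>"] assms by linarith
    then show "1 \<le> A powr (1 - \<beta>) / (1 - \<beta>)"
      using assms by simp
    show "real N powr (1 - \<beta>) / (1 - \<beta>) \<le> A powr (1 - \<beta>) / (1 - \<beta>)"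
      using assms N by (intro divide_right_mono powr_mono2) auto
  qed (use assms in auto)
  finally show ?thesis by simp
qed

text \<open>The bracket dominates 1 and every coordinate, so its power splits into one factor of
  exponent -\<beta> per coordinate. Frequencies with bracket at most \<open>A\<close> lie in a cube,
  over which the sum of products is a power of the one-dimensional sum.\<close>

lemma sum_bracket_powr_le:
  fixes F :: "(int ^ 'n) set"
  assumes "0 \<le> \<beta>" "\<beta> < 1" "1 \<le> A" "\<And>k. k \<in> F \<Longrightarrow> bracket k \<le> A"
  shows "(\<Sum>k\<in>F. bracket k powr - (real CARD('n) * \<beta>)) \<le> (3 / (1 - \<beta>) * A powr (1 - \<beta>)) ^ CARD('n)"
proof -
  define I where "I = {m. real_of_int \<bar>m\<bar> \<le> A}"
  let ?b = "\<lambda>m. max 1 (real_of_int \<bar>m\<bar>) powr - \<beta>"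
  have "I \<subseteq> {- \<lceil>A\<rceil>..\<lceil>A\<rceil>}"
    by (auto simp: I_def) linarith+
  then have fin: "finite I" by (rule finite_subset) simp
  have box: "bij_betw vec_lambda (PiE UNIV (\<lambda>_ :: 'n. I)) {k. \<forall>i. k $ i \<in> I}"
    by (rule bij_betwI[where g = vec_nth]) auto
  then have finbox: "finite {k :: int ^ 'n. \<forall>i. k $ i \<in> I}"
    using fin by (metis bij_betw_finite finite_PiE finite_code)
  have le: "bracket k powr - (real CARD('n) * \<beta>) \<le> (\<Prod>i\<in>UNIV. ?b (k $ i))" for k :: "int ^ 'n"
  proof -
    have "bracket k powr - (real CARD('n) * \<beta>) = (\<Prod>i\<in>(UNIV :: 'n set). bracket k powr - \<beta>)"
      using less_imp_neq[OF bracket_pos[of k]] by (simp add: powr_power)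
    also have "\<dots> \<le> (\<Prod>i\<in>UNIV. ?b (k $ i))"
      using bracket_ge_1[of k] abs_component_le_bracket[of k] assms(1)
      by (intro prod_mono conjI powr_mono2') auto
    finally show ?thesis .
  qed
  have "(\<Sum>k\<in>F. bracket k powr - (real CARD('n) * \<beta>))
      \<le> (\<Sum>k\<in>F. \<Prod>i\<in>UNIV. ?b (k $ i))"
    by (intro sum_mono le)
  also have "\<dots> \<le> (\<Sum>k\<in>{k :: int ^ 'n. \<forall>i. k $ i \<in> I}. \<Prod>i\<in>UNIV. ?b (k $ i))"
  proof (intro sum_mono2 finbox subsetI)
    show "k \<in> {k. \<forall>i. k $ i \<in> I}" if "k \<in> F" for k
      using order_trans[OF abs_component_le_bracket assms(4)[OF that]] by (simp add: I_def)
  qed (auto intro!: prod_nonneg)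
  also have "\<dots> = (\<Sum>f\<in>PiE UNIV (\<lambda>_ :: 'n. I). \<Prod>i\<in>UNIV. ?b (f i))"
    by (subst sum.reindex_bij_betw[OF box, symmetric]) simp
  also have "\<dots> = (\<Sum>m\<in>I. ?b m) ^ CARD('n)"
    using prod_sum_PiE[of "UNIV :: 'n set" "\<lambda>_. I" "\<lambda>_. ?b"] fin by simp
  also have "\<dots> \<le> (3 / (1 - \<beta>) * A powr (1 - \<beta>)) ^ CARD('n)"
    unfolding I_def by (intro power_mono sum_int_powr_le assms) (auto intro: sum_nonneg)
  finally show ?thesis .
qed

section \<open>Level sets and the splitting into low and high frequencies\<close>

lemma nn_integral_powr:
  assumes "a > -1" "c \<ge> 0"
  shows "(\<integral>\<^sup>+ t. ennreal (indicator {0..c} t * t powr a) \<partial>lborel) = ennreal (c powr (a + 1) / (a + 1))"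
  using nn_integral_has_integral_lebesgue[OF _ has_integral_powr_from_0[OF assms]]
  by simp

lemma sigma_finite_measure_torus: "sigma_finite_measure (torus :: (real ^ 'n) measure)"
  using finite_measure_torus by (rule finite_measure.axioms)

text \<open>This is the form \<open>CARD('n) * \<beta>\<close> with \<beta> = 1 - 2/q below 1 that
  the lattice sums require.\<close>

lemma sobolev_exponent_ge_2:
  assumes "2 \<le> q"
  shows "2 * sobolev_exponent TYPE('n) q = real CARD('n) * (1 - 2 / q)"
  using assms by (simp add: sobolev_exponent_def field_simps)

text \<open>Each value f(x)^q is the integral of q t^(q-1) over t from 0 to f(x); Tonelli's theorem
  then exchanges the integrals over \<open>x\<close> and \<open>t\<close>.\<close>

lemma layer_cake_powr:
  fixes f :: "real ^ 'n \<Rightarrow> real"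
  assumes [measurable]: "f \<in> borel_measurable torus" and f: "\<And>x. 0 \<le> f x" and q: "1 < q"
  shows "(\<integral>\<^sup>+ x. ennreal (f x powr q) \<partial>torus)
    = (\<integral>\<^sup>+ t. \<integral>\<^sup>+ x. ennreal (indicator {0..f x} t * (q * t powr (q - 1))) \<partial>torus \<partial>lborel)"
proof -
  interpret sigma_finite_measure "torus :: (real ^ 'n) measure" by (rule sigma_finite_measure_torus)
  interpret pair_sigma_finite "torus :: (real ^ 'n) measure" "lborel :: real measure" ..
  have "ennreal (f x powr q) = (\<integral>\<^sup>+ t. ennreal (indicator {0..f x} t * (q * t powr (q - 1))) \<partial>lborel)" for x
  proof -
    have "(\<integral>\<^sup>+ t. ennreal (indicator {0..f x} t * (q * t powr (q - 1))) \<partial>lborel)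
        = (\<integral>\<^sup>+ t. ennreal q * ennreal (indicator {0..f x} t * t powr (q - 1)) \<partial>lborel)"
      using q by (intro nn_integral_cong) (simp add: mult.left_commute flip: ennreal_mult)
    also have "\<dots> = ennreal q * ennreal (f x powr q / q)"
      using q f by (subst nn_integral_cmult) (simp_all add: nn_integral_powr)
    also have "\<dots> = ennreal (f x powr q)"
      using q by (simp flip: ennreal_mult)
    finally show ?thesis by simp
  qed
  moreover have "(\<lambda>(x, t). ennreal (indicator {0..f x} t * (q * t powr (q - 1))))
      \<in> borel_measurable (torus \<Otimes>\<^sub>M lborel)"
    by (simp add: indicator_def of_bool_def atLeastAtMost_iff cong: if_cong)
  ultimately show ?thesis
    by (simp add: Fubini')
qed

text \<open>The modulus is at most the sum of the moduli of the coefficients. Cauchy-Schwarz with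
  the weights bracket^\<sigma> and bracket^(-\<sigma>) separates the Sobolev norm from a lattice
  sum, which is bounded by \<open>sum_bracket_powr_le\<close>.\<close>

lemma cmod_trig_low_le:
  fixes F :: "(int ^ 'n) set"
  assumes "0 \<le> \<beta>" "\<beta> < 1" "0 < A" "\<And>k. k \<in> F \<Longrightarrow> bracket k \<le> A"
  shows "cmod (trig F c x) \<le> sqrt ((3 / (1 - \<beta>)) ^ CARD('n)) * A powr (real CARD('n) * (1 - \<beta>) / 2)
    * sqrt (\<Sum>k\<in>F. bracket k powr (real CARD('n) * \<beta>) * (cmod (c k))\<^sup>2)"
\<comment> \<open>The lattice sum bound needs a cutoff of at least 1; as brackets are at least 1, a
  smaller cutoff admits no frequency at all.\<close>
proof (cases "A < 1")
  case True
  then have "k \<notin> F" for k using assms(4)[of k] bracket_ge_1[of k] by linarith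
  then have "F = {}" by auto
  then show ?thesis by (simp add: trig_def)
next
  case False
  define \<sigma> where "\<sigma> = real CARD('n) * \<beta> / 2"
  have "cmod (trig F c x) \<le> (\<Sum>k\<in>F. cmod (c k))"
    unfolding trig_def by (rule order_trans[OF norm_sum]) (simp add: norm_mult)
  also have "\<dots> = (\<Sum>k\<in>F. \<bar>bracket k powr - \<sigma>\<bar> * \<bar>bracket k powr \<sigma> * cmod (c k)\<bar>)"
    by (intro sum.cong) (simp_all add: abs_mult powr_minus less_imp_neq[OF bracket_pos, symmetric])
  also have "\<dots> \<le> L2_set (\<lambda>k. bracket k powr - \<sigma>) F * L2_set (\<lambda>k. bracket k powr \<sigma> * cmod (c k)) F"
    by (rule L2_set_mult_ineq)
  also have "L2_set (\<lambda>k. bracket k powr \<sigma> * cmod (c k)) F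
      = sqrt (\<Sum>k\<in>F. bracket k powr (real CARD('n) * \<beta>) * (cmod (c k))\<^sup>2)"
    by (simp add: L2_set_def power_mult_distrib powr_power less_imp_neq[OF bracket_pos, symmetric] \<sigma>_def)
  also have "L2_set (\<lambda>k. bracket k powr - \<sigma>) F = sqrt (\<Sum>k\<in>F. bracket k powr - (real CARD('n) * \<beta>))"
    by (simp add: L2_set_def powr_power less_imp_neq[OF bracket_pos, symmetric] \<sigma>_def)
  also have "\<dots> \<le> sqrt ((3 / (1 - \<beta>) * A powr (1 - \<beta>)) ^ CARD('n))"
    using False by (intro real_sqrt_le_mono sum_bracket_powr_le assms) auto
  also have "\<dots> = sqrt ((3 / (1 - \<beta>)) ^ CARD('n)) * A powr (real CARD('n) * (1 - \<beta>) / 2)"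
    using False by (simp only: power_mult_distrib real_sqrt_mult)
      (simp add: powr_power powr_half_sqrt[symmetric] powr_powr)
  finally show ?thesis
    by (simp add: mult_right_mono sum_nonneg)
qed


text \<open>The strict inequality q > 2 makes t^(q-3) integrable at 0, and the constant blows up as
  q tends to 2. \<open>K\<close> is the constant of \<open>cmod_trig_low_le\<close> at \<beta> = 1 -
  2/q, where 1 - \<beta> = 2/q.\<close>

lemma trig_sobolev_bound:
  fixes F :: "(int ^ 'n) set" and c :: "int ^ 'n \<Rightarrow> complex" and q :: real
  defines "M \<equiv> sqrt (\<Sum>k\<in>F. bracket k powr (2 * sobolev_exponent TYPE('n) q) * (cmod (c k))\<^sup>2)"
    and "K \<equiv> sqrt ((3 / (2 / q)) ^ CARD('n))"
  assumes q: "2 < q" and F: "finite F"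
  shows "(\<integral>\<^sup>+ x. ennreal (cmod (trig F c x) powr q) \<partial>torus)
    \<le> ennreal (4 * q / (q - 2) * (2 * K) powr (q - 2) * M powr q)"
proof (cases "M = 0")
  \<comment> \<open>The cutoff in the other case divides by \<open>M\<close>. When \<open>M\<close>
    vanishes, so do all coefficients, the weights being positive.\<close>
  case True
  then have "\<forall>k\<in>F. bracket k powr (2 * sobolev_exponent TYPE('n) q) * (cmod (c k))\<^sup>2 = 0"
    using F unfolding M_def by (subst sum_nonneg_eq_0_iff[symmetric]) auto
  then have "\<forall>k\<in>F. c k = 0"
    using less_imp_neq[OF bracket_pos] by (metis mult_eq_0_iff norm_eq_zero power2_eq_square powr_eq_0_iff)
  then show ?thesis by (simp add: trig_def)
next
  case False
  define \<beta> where "\<beta> = 1 - 2 / q"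
  define e where "e = real CARD('n) * (1 - \<beta>) / 2"
  \<comment> \<open>The frequency \<open>k\<close> counts as high exactly at the heights up to \<open>L k\<close>.\<close>
  define L where "L k = 2 * K * M * bracket k powr e" for k :: "int ^ 'n"
  have M: "0 < M"
    using False unfolding M_def by (auto simp: less_le intro!: sum_nonneg)
  have K: "0 < K" using q by (simp add: K_def)
  have e: "0 < e" using q by (simp add: e_def \<beta>_def)
  have \<beta>: "0 \<le> \<beta>" "\<beta> < 1" using q by (simp_all add: \<beta>_def field_simps)
  have exp: "2 * sobolev_exponent TYPE('n) q = real CARD('n) * \<beta>"
    using q by (simp add: sobolev_exponent_ge_2 \<beta>_def)
  have M2: "M\<^sup>2 = (\<Sum>k\<in>F. bracket k powr (real CARD('n) * \<beta>) * (cmod (c k))\<^sup>2)"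
    unfolding M_def exp by (simp add: sum_nonneg)
  have low: "cmod (trig {k \<in> F. L k < t} c x) \<le> t / 2" if t: "0 < t" for t x
  proof -
    \<comment> \<open>\<open>A\<close> solves K A^e M = t / 2, so the bound on low parts becomes t /
      2; a frequency with \<open>L k < t\<close> has bracket at most \<open>A\<close>.\<close>
    define A where "A = (t / (2 * K * M)) powr (1 / e)"
    have "cmod (trig {k \<in> F. L k < t} c x) \<le> K * A powr e
        * sqrt (\<Sum>k\<in>{k \<in> F. L k < t}. bracket k powr (real CARD('n) * \<beta>) * (cmod (c k))\<^sup>2)"
    proof -
      have "bracket k \<le> A" if "L k < t" for k
      proof -
        have "bracket k powr e \<le> t / (2 * K * M)"
          using that K M by (simp add: L_def field_simps)
        then have "(bracket k powr e) powr (1 / e) \<le> A"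
          unfolding A_def using e by (intro powr_mono2) auto
        then show ?thesis
          using e by (simp add: powr_powr less_imp_neq[OF bracket_pos, symmetric] less_imp_le)
      qed
      moreover have "0 < A" using t K M by (simp add: A_def)
      ultimately show ?thesis
        using cmod_trig_low_le[OF \<beta>, of A "{k \<in> F. L k < t}" c x]
        by (simp add: e_def K_def \<beta>_def)
    qed
    also have "\<dots> \<le> K * A powr e * M"
      unfolding M_def exp using F K by (intro mult_left_mono real_sqrt_le_mono sum_mono2) auto
    also have "A powr e = t / (2 * K * M)"
      using e t K M by (simp add: A_def powr_powr)
    also have "K * (t / (2 * K * M)) * M = t / 2"
      using K M by (simp add: field_simps)
    finally show ?thesis .
  qed
  have level: "(\<integral>\<^sup>+ x. ennreal (indicator {0..cmod (trig F c x)} t * (q * t powr (q - 1))) \<partial>torus)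
      \<le> (\<Sum>k\<in>F. ennreal (4 * q * (cmod (c k))\<^sup>2) * ennreal (indicator {0..L k} t * t powr (q - 3)))" for t
  proof (cases "0 < t")
    case True
    define H where "H = {k \<in> F. t \<le> L k}"
    have H: "finite H" "H = F \<inter> {k. t \<le> L k}" using F by (auto simp: H_def)
    \<comment> \<open>Chebyshev's argument: where the polynomial reaches height \<open>t\<close>,
      its high part is at least t / 2. Multiplying by the square of the high part over (t / 2)^2
      turns t^(q-1) into t^(q-3) and brings in the factor 4.\<close>
    have "indicator {0..cmod (trig F c x)} t * (q * t powr (q - 1))
        \<le> 4 * q * t powr (q - 3) * (cmod (trig H c x))\<^sup>2" for x
    proof (cases "t \<le> cmod (trig F c x)")
      case le: True
      have "trig F c x = trig H c x + trig {k \<in> F. L k < t} c x"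
        unfolding trig_def using F
        by (subst sum.union_disjoint[symmetric]) (auto simp: H_def intro!: sum.cong)
      then have "cmod (trig F c x) \<le> cmod (trig H c x) + t / 2"
        using norm_triangle_ineq[of "trig H c x" "trig {k \<in> F. L k < t} c x"] low[OF True, of x] by simp
      then have "t / 2 \<le> cmod (trig H c x)" using le by simp
      then have "(t / 2)\<^sup>2 \<le> (cmod (trig H c x))\<^sup>2"
        using True by (intro power_mono) auto
      then have "4 * q * t powr (q - 3) * (t / 2)\<^sup>2 \<le> 4 * q * t powr (q - 3) * (cmod (trig H c x))\<^sup>2"
        using q by (intro mult_left_mono) auto
      moreover have "4 * q * t powr (q - 3) * (t / 2)\<^sup>2 = q * t powr (q - 1)"
        using True by (simp add: power_divide powr_diff powr_numeral field_simps power3_eq_cube power2_eq_square)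
      ultimately show ?thesis using q True le by (simp add: indicator_def)
    qed (use q in simp)
    then have "(\<integral>\<^sup>+ x. ennreal (indicator {0..cmod (trig F c x)} t * (q * t powr (q - 1))) \<partial>torus)
        \<le> (\<integral>\<^sup>+ x. ennreal (4 * q * t powr (q - 3)) * ennreal ((cmod (trig H c x))\<^sup>2) \<partial>torus)"
      using q by (intro nn_integral_mono) (simp add: ennreal_leI flip: ennreal_mult)
    also have "\<dots> = ennreal (4 * q * t powr (q - 3)) * ennreal (\<Sum>k\<in>H. (cmod (c k))\<^sup>2)"
      by (subst nn_integral_cmult) (simp_all add: nn_integral_cmod_trig_square H(1))
    also have "\<dots> = ennreal (\<Sum>k\<in>H. 4 * q * t powr (q - 3) * (cmod (c k))\<^sup>2)"
      using q by (simp add: sum_distrib_left sum_nonneg flip: ennreal_mult)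
    \<comment> \<open>Membership in \<open>H\<close> means that \<open>t\<close> is at most
      \<open>L k\<close>. As an indicator it lets the sum run over all of \<open>F\<close>, to be
      integrated in \<open>t\<close> one frequency at a time.\<close>
    also have "(\<Sum>k\<in>H. 4 * q * t powr (q - 3) * (cmod (c k))\<^sup>2)
        = (\<Sum>k\<in>F. 4 * q * (cmod (c k))\<^sup>2 * (indicator {0..L k} t * t powr (q - 3)))"
      unfolding H(2) using F True by (subst sum.inter_restrict) (auto intro!: sum.cong simp: indicator_def)
    also have "ennreal \<dots> = (\<Sum>k\<in>F. ennreal (4 * q * (cmod (c k))\<^sup>2) * ennreal (indicator {0..L k} t * t powr (q - 3)))"
      using q by (simp add: sum_ennreal flip: ennreal_mult)
    finally show ?thesis .
  next
    case False
    \<comment> \<open>At negative heights the indicator vanishes; at height zero the power does,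
      since \<open>0 powr (q - 1) = 0\<close>.\<close>
    then have "indicator {0..cmod (trig F c x)} t * (q * t powr (q - 1)) = 0" for x
      by (cases "t = 0") auto
    then show ?thesis by (simp only:) simp
  qed
  have "(\<integral>\<^sup>+ x. ennreal (cmod (trig F c x) powr q) \<partial>torus)
      \<le> (\<integral>\<^sup>+ t. (\<Sum>k\<in>F. ennreal (4 * q * (cmod (c k))\<^sup>2) * ennreal (indicator {0..L k} t * t powr (q - 3))) \<partial>lborel)"
    using q by (subst layer_cake_powr) (auto intro!: nn_integral_mono level)
  also have "\<dots> = (\<Sum>k\<in>F. ennreal (4 * q * (cmod (c k))\<^sup>2) * ennreal (L k powr (q - 2) / (q - 2)))"
  proof -
    have "0 \<le> L k" for k using K M by (simp add: L_def)
    then show ?thesis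
      using q nn_integral_powr[of "q - 3"]
      by (subst nn_integral_sum) (simp_all add: nn_integral_cmult)
  qed
  also have "\<dots> = ennreal (\<Sum>k\<in>F. 4 * q * (cmod (c k))\<^sup>2 * (L k powr (q - 2) / (q - 2)))"
    using q by (simp add: sum_ennreal flip: ennreal_mult)
  also have "(\<Sum>k\<in>F. 4 * q * (cmod (c k))\<^sup>2 * (L k powr (q - 2) / (q - 2)))
      = 4 * q / (q - 2) * (2 * K * M) powr (q - 2) * M\<^sup>2"
  proof -
    \<comment> \<open>By this identity \<open>L k powr (q - 2)\<close> carries exactly the Sobolev
      weight, so the sum over \<open>F\<close> reproduces M^2.\<close>
    have "e * (q - 2) = real CARD('n) * \<beta>"
      using q by (simp add: e_def \<beta>_def field_simps)
    then have "L k powr (q - 2) = (2 * K * M) powr (q - 2) * bracket k powr (real CARD('n) * \<beta>)" for k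
      using K M by (simp add: L_def powr_mult powr_powr)
    then show ?thesis
      unfolding M2 by (simp add: sum_distrib_left sum_divide_distrib mult_ac)
  qed
  also have "\<dots> = 4 * q / (q - 2) * (2 * K) powr (q - 2) * M powr q"
    using K M by (simp add: powr_mult powr_diff powr_numeral)
  finally show ?thesis .
qed

text \<open>At q = 2 the exponent is zero and Parseval's identity gives constant 1. Above 2 the q-th
  root of the constant in \<open>trig_sobolev_bound\<close> moves inside the power.\<close>

lemma trig_sobolev:
  assumes "2 \<le> q"
  shows "\<exists>C>0. \<forall>(F :: (int ^ 'n) set) c. finite F \<longrightarrow>
    (\<integral>\<^sup>+ x. ennreal (cmod (trig F c x) powr q) \<partial>torus)
      \<le> ennreal ((C * sqrt (\<Sum>k\<in>F. bracket k powr (2 * sobolev_exponent TYPE('n) q) * (cmod (c k :: complex))\<^sup>2)) powr q)"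
proof (cases "q = 2")
  case True
  have "(\<integral>\<^sup>+ x. ennreal (cmod (trig F c x) powr 2) \<partial>torus)
    = ennreal ((1 * sqrt (\<Sum>k\<in>F. bracket k powr (2 * sobolev_exponent TYPE('n) 2) * (cmod (c k))\<^sup>2)) powr 2)"
    if "finite F" for F :: "(int ^ 'n) set" and c
    using nn_integral_cmod_trig_square[OF that, of c]
    by (simp add: sobolev_exponent_def less_imp_neq[OF bracket_pos, symmetric] sum_nonneg)
  then show ?thesis
    unfolding True by (intro exI[of _ 1] conjI allI impI zero_less_one eq_refl)
next
  case False
  define K where "K = sqrt ((3 / (2 / q)) ^ CARD('n))"
  define D where "D = 4 * q / (q - 2) * (2 * K) powr (q - 2)"
  have D: "0 < D" using assms False by (simp add: D_def K_def)
  show ?thesis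
  proof (intro exI[of _ "D powr (1 / q)"] conjI allI impI)
    fix F :: "(int ^ 'n) set" and c :: "int ^ 'n \<Rightarrow> complex"
    assume "finite F"
    have "(D powr (1 / q) * S) powr q = D * S powr q" if "0 \<le> S" for S
      using D assms that by (simp add: powr_mult powr_powr)
    with trig_sobolev_bound[OF _ \<open>finite F\<close>, of q c, folded K_def, folded D_def] assms False
    show "(\<integral>\<^sup>+ x. ennreal (cmod (trig F c x) powr q) \<partial>torus)
      \<le> ennreal ((D powr (1 / q) * sqrt (\<Sum>k\<in>F. bracket k powr (2 * sobolev_exponent TYPE('n) q) * (cmod (c k))\<^sup>2)) powr q)"
      by (simp add: sum_nonneg)
  qed (use D in simp)
qed

section \<open>Lebesgue norms and the dual embedding\<close>

lemma ennreal_powr_le_iff: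
  assumes "0 < a" "0 \<le> B"
  shows "ennreal_powr x a \<le> ennreal B \<longleftrightarrow> x \<le> ennreal (B powr (1 / a))"
proof (cases x)
  case (real r)
  have "r powr a \<le> B \<longleftrightarrow> r \<le> B powr (1 / a)"
  proof
    assume "r powr a \<le> B"
    then have "(r powr a) powr (1 / a) \<le> B powr (1 / a)"
      using assms by (intro powr_mono2) auto
    then show "r \<le> B powr (1 / a)"
      using assms real by (simp add: powr_powr)
  next
    assume "r \<le> B powr (1 / a)"
    then have "r powr a \<le> (B powr (1 / a)) powr a"
      using assms real by (intro powr_mono2) auto
    then show "r powr a \<le> B"
      using assms by (simp add: powr_powr)
  qed
  then show ?thesis
    using real assms by (simp add: ennreal_powr_def)
qed (simp add: ennreal_powr_def top_unique)

lemma power2_ennreal_powr_half: "(ennreal_powr x (1 / 2))\<^sup>2 = x"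
  by (cases x) (simp_all add: ennreal_powr_def ennreal_power powr_half_sqrt)

lemma Lp_norm_fun_le_iff:
  assumes "0 < p" "0 \<le> B"
  shows "Lp_norm_fun p h \<le> ennreal B \<longleftrightarrow> (\<integral>\<^sup>+ x. ennreal (cmod (h x) powr p) \<partial>torus) \<le> ennreal (B powr p)"
  using assms unfolding Lp_norm_fun_def by (subst ennreal_powr_le_iff) simp_all

text \<open>Young's inequality is applied pointwise to \<open>f\<close> and \<open>g\<close> scaled
  by the bounds \<open>A\<close> and \<open>B\<close> on their norms, whence the positivity of both
  bounds.\<close>

lemma nn_integral_Hoelder_pos:
  fixes f g :: "'a \<Rightarrow> real"
  assumes pq: "1 < p" "1 < q" "1 / p + 1 / q = 1"
    and [measurable]: "f \<in> borel_measurable M" "g \<in> borel_measurable M"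
    and pos: "\<And>x. 0 \<le> f x" "\<And>x. 0 \<le> g x" "0 < A" "0 < B"
    and f: "(\<integral>\<^sup>+ x. ennreal (f x powr p) \<partial>M) \<le> ennreal (A powr p)"
    and g: "(\<integral>\<^sup>+ x. ennreal (g x powr q) \<partial>M) \<le> ennreal (B powr q)"
  shows "(\<integral>\<^sup>+ x. ennreal (f x * g x) \<partial>M) \<le> ennreal (A * B)"
proof -
  \<comment> \<open>These are the coefficients in Young's inequality for f/A and g/B after
    multiplying back by \<open>A * B\<close>.\<close>
  define a where "a = A * B / (p * A powr p)"
  define b where "b = A * B / (q * B powr q)"
  have ab: "0 \<le> a" "0 \<le> b" using pq pos by (simp_all add: a_def b_def)
  have "f x * g x \<le> a * f x powr p + b * g x powr q" for x
  proof -
    have "(f x / A) * (g x / B) \<le> (f x / A) powr p / p + (g x / B) powr q / q"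
      using pq pos by (intro Youngs_inequality) auto
    then have "(A * B) * ((f x / A) * (g x / B)) \<le> (A * B) * ((f x / A) powr p / p + (g x / B) powr q / q)"
      using pos by (intro mult_left_mono) auto
    then show ?thesis
      using pos by (simp add: a_def b_def powr_divide distrib_left mult_ac)
  qed
  then have "(\<integral>\<^sup>+ x. ennreal (f x * g x) \<partial>M)
      \<le> (\<integral>\<^sup>+ x. ennreal a * ennreal (f x powr p) + ennreal b * ennreal (g x powr q) \<partial>M)"
    using ab by (intro nn_integral_mono) (simp add: ennreal_leI flip: ennreal_mult ennreal_plus)
  also have "\<dots> = ennreal a * (\<integral>\<^sup>+ x. ennreal (f x powr p) \<partial>M) + ennreal b * (\<integral>\<^sup>+ x. ennreal (g x powr q) \<partial>M)"
    by (subst nn_integral_add) (simp_all add: nn_integral_cmult)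
  also have "\<dots> \<le> ennreal a * ennreal (A powr p) + ennreal b * ennreal (B powr q)"
    by (intro add_mono mult_left_mono f g) auto
  also have "\<dots> = ennreal (a * A powr p + b * B powr q)"
    using ab by (simp flip: ennreal_mult ennreal_plus)
  also have "a * A powr p + b * B powr q = A * B * (1 / p + 1 / q)"
    using pq pos by (simp add: a_def b_def field_simps)
  finally show ?thesis using pq(3) by simp
qed

lemma nn_integral_Hoelder:
  fixes f g :: "'a \<Rightarrow> real"
  assumes pq: "1 < p" "1 < q" "1 / p + 1 / q = 1"
    and meas: "f \<in> borel_measurable M" "g \<in> borel_measurable M"
    and pos: "\<And>x. 0 \<le> f x" "\<And>x. 0 \<le> g x" "0 \<le> A" "0 \<le> B"
    and f: "(\<integral>\<^sup>+ x. ennreal (f x powr p) \<partial>M) \<le> ennreal (A powr p)"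
    and g: "(\<integral>\<^sup>+ x. ennreal (g x powr q) \<partial>M) \<le> ennreal (B powr q)"
  shows "(\<integral>\<^sup>+ x. ennreal (f x * g x) \<partial>M) \<le> ennreal (A * B)"
proof (rule tendsto_lowerbound)
  show "((\<lambda>e. ennreal ((A + e) * (B + e))) \<longlongrightarrow> ennreal (A * B)) (at_right 0)"
    by (rule tendsto_ennrealI) (auto intro!: tendsto_eq_intros)
  show "\<forall>\<^sub>F e in at_right 0. (\<integral>\<^sup>+ x. ennreal (f x * g x) \<partial>M) \<le> ennreal ((A + e) * (B + e))"
  proof (rule eventually_at_right_less[THEN eventually_mono])
    fix e :: real assume e: "0 < e"
    have "ennreal (A powr p) \<le> ennreal ((A + e) powr p)" "ennreal (B powr q) \<le> ennreal ((B + e) powr q)"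
      using e pq pos by (auto intro!: ennreal_leI powr_mono2)
    with e pos f g show "(\<integral>\<^sup>+ x. ennreal (f x * g x) \<partial>M) \<le> ennreal ((A + e) * (B + e))"
      by (intro nn_integral_Hoelder_pos[OF pq meas]) (auto intro: order_trans)
  qed
qed simp

text \<open>Hoelder's inequality for |h|^p against the constant 1, with exponents q/p and q/(q-p).
  The torus has total mass 1, so no constant appears.\<close>

lemma Lp_norm_fun_mono:
  assumes [measurable]: "h \<in> borel_measurable torus" and p: "0 < p" "p \<le> q"
  shows "Lp_norm_fun p h \<le> Lp_norm_fun q (h :: real ^ 'n \<Rightarrow> complex)"
proof (cases "p = q \<or> Lp_norm_fun q h = top")
  case False
  then have pq: "p < q" using p by simp
  obtain B where B: "0 \<le> B" "Lp_norm_fun q h = ennreal B"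
    using False by (cases "Lp_norm_fun q h") auto
  have "(\<integral>\<^sup>+ x. ennreal (cmod (h x) powr p * 1) \<partial>(torus :: (real ^ 'n) measure)) \<le> ennreal (B powr p * 1)"
  proof (rule nn_integral_Hoelder[where p = "q / p" and q = "q / (q - p)"])
    have "(\<integral>\<^sup>+ x. ennreal (cmod (h x) powr q) \<partial>torus) \<le> ennreal (B powr q)"
      using Lp_norm_fun_le_iff[of q B h] B p by simp
    then show "(\<integral>\<^sup>+ x. ennreal ((cmod (h x) powr p) powr (q / p)) \<partial>torus) \<le> ennreal ((B powr p) powr (q / p))"
      using p by (simp add: powr_powr)
  qed (use p pq B(1) in \<open>simp_all add: emeasure_space_torus field_simps\<close>)
  then show ?thesis
    using Lp_norm_fun_le_iff[of p B h] B p by simp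
qed auto

text \<open>Both infima run over the same representing functions, so the comparison for a single
  function suffices; without a representative both sides are top.\<close>

lemma Lp_norm_mono:
  fixes u :: "(real ^ 'n \<Rightarrow> complex) \<Rightarrow> complex"
  assumes "0 < p" "p \<le> q"
  shows "Lp_norm p u \<le> Lp_norm q u"
  unfolding Lp_norm_def
  using assms by (intro INF_mono) (auto intro!: exI Lp_norm_fun_mono)

section \<open>Duality: weighted coefficient sums bounded by Lebesgue norms below 2\<close>

lemma sobolev_exponent_dual:
  assumes "1 < p" 
  shows "sobolev_exponent TYPE('n) (p / (p - 1)) = sobolev_exponent TYPE('n) p"
proof -
  have "(p / (p - 1) - 2) / (2 * (p / (p - 1))) = - ((p - 2) / (2 * p))"
    using assms by (simp add: field_simps)
  then show ?thesis by (simp add: sobolev_exponent_def)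
qed

text \<open>Hoelder's inequality against a trigonometric polynomial, which
  \<open>trig_sobolev\<close> bounds at the conjugate exponent \<open>q\<close>, gives S \<le> B C
  sqrt(S) for the weighted sum \<open>S\<close>. Since \<open>S\<close> is a finite real number,
  sqrt(S) cancels.\<close>

lemma dual_sobolev_fun:
  assumes "1 < p" "p \<le> 2"
  shows "\<exists>C>0. \<forall>(h :: real ^ 'n \<Rightarrow> complex) B F. integrable torus h \<longrightarrow> 0 \<le> B \<longrightarrow> Lp_norm_fun p h \<le> ennreal B \<longrightarrow> finite F \<longrightarrow>
    (\<Sum>k\<in>F. bracket k powr - (2 * sobolev_exponent TYPE('n) p) * (cmod (fourier (dist_of_fun h) k))\<^sup>2) \<le> (C * B)\<^sup>2"
proof -
  define q where "q = p / (p - 1)"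
  define \<sigma> where "\<sigma> = 2 * sobolev_exponent TYPE('n) p"
  have q: "2 \<le> q" "1 / p + 1 / q = 1" using assms by (simp_all add: q_def field_simps)
  have \<sigma>: "2 * sobolev_exponent TYPE('n) q = \<sigma>"
    using assms by (simp add: q_def \<sigma>_def sobolev_exponent_dual)
  obtain C where C: "0 < C" "\<And>(F :: (int ^ 'n) set) c. finite F \<Longrightarrow>
    (\<integral>\<^sup>+ x. ennreal (cmod (trig F c x) powr q) \<partial>torus)
      \<le> ennreal ((C * sqrt (\<Sum>k\<in>F. bracket k powr \<sigma> * (cmod (c k))\<^sup>2)) powr q)"
    using trig_sobolev[OF q(1), where 'n = 'n] unfolding \<sigma> by blast
  show ?thesis
    unfolding \<sigma>_def[symmetric]
  proof (intro exI[of _ C] conjI C(1) allI impI)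
    fix h :: "real ^ 'n \<Rightarrow> complex" and B and F :: "(int ^ 'n) set"
    assume h: "integrable torus h" and B: "0 \<le> B" "Lp_norm_fun p h \<le> ennreal B" and F: "finite F"
    \<comment> \<open>The weights make the pairing of \<open>h\<close> with the polynomial and the square of the polynomial's
      Sobolev norm both equal to \<open>S\<close>.\<close>
    define c where "c k = of_real (bracket k powr - \<sigma>) * fourier (dist_of_fun h) k" for k
    define S where "S = (\<Sum>k\<in>F. bracket k powr - \<sigma> * (cmod (fourier (dist_of_fun h) k))\<^sup>2)"
    have S: "0 \<le> S" by (simp add: S_def sum_nonneg)
    have "(LINT x|torus. h x * cnj (trig F c x)) = of_real S"
      unfolding integral_mult_cnj_trig[OF h] S_def of_real_sum
      by (intro sum.cong refl) (simp add: c_def complex_norm_square mult_ac del: of_real_power)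
    then have "ennreal S = ennreal (cmod (LINT x|torus. h x * cnj (trig F c x)))"
      using S by simp
    also have "\<dots> \<le> (\<integral>\<^sup>+ x. ennreal (cmod (h x * cnj (trig F c x))) \<partial>torus)"
      by (intro integral_norm_bound_ennreal integrable_mult_bounded_torus h continuous_intros)
    also have "\<dots> = (\<integral>\<^sup>+ x. ennreal (cmod (h x) * cmod (trig F c x)) \<partial>torus)"
      by (simp add: norm_mult)
    also have "\<dots> \<le> ennreal (B * (C * sqrt (\<Sum>k\<in>F. bracket k powr \<sigma> * (cmod (c k))\<^sup>2)))"
      using assms q h B C(1) Lp_norm_fun_le_iff[of p B h]
      by (intro nn_integral_Hoelder[where p = p and q = q] C(2)[OF F])
        (auto intro!: mult_nonneg_nonneg real_sqrt_ge_zero sum_nonneg)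
    also have "(\<Sum>k\<in>F. bracket k powr \<sigma> * (cmod (c k))\<^sup>2) = S"
    proof -
      have "cmod (c k) = bracket k powr - \<sigma> * cmod (fourier (dist_of_fun h) k)" for k
        by (simp add: c_def norm_mult)
      then show ?thesis
        unfolding S_def
        by (intro sum.cong refl)
          (simp add: powr_minus power2_eq_square field_simps less_imp_neq[OF bracket_pos, symmetric])
    qed
    finally have "S \<le> C * B * sqrt S"
      using S B C(1) by (simp add: mult_ac)
    then have "sqrt S * sqrt S \<le> (C * B) * sqrt S" using S by simp
    then have "sqrt S \<le> C * B"
      using S B C(1) mult_right_le_imp_le[of "sqrt S" "sqrt S" "C * B"] by (cases "S = 0") auto
    then have "(sqrt S)\<^sup>2 \<le> (C * B)\<^sup>2" using S by (intro power_mono) auto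
    then show "(\<Sum>k\<in>F. bracket k powr - \<sigma> * (cmod (fourier (dist_of_fun h) k))\<^sup>2) \<le> (C * B)\<^sup>2"
      using S by (simp flip: S_def)
  qed
qed

section \<open>Fourier coefficients of the Radon transform\<close>

lemma has_derivative_character:
  "((\<lambda>x. a * character k x) has_derivative
     (\<lambda>h. a * (\<i> * of_real (2 * pi * (real_vec k \<bullet> h))) * character k x)) (at x)"
proof -
  have "((\<lambda>x. \<i> * of_real (2 * pi * (real_vec k \<bullet> x)) :: complex) has_derivative
      (\<lambda>h. \<i> * of_real (2 * pi * (real_vec k \<bullet> h)))) (at x)"
    by (intro derivative_intros)
  from has_derivative_mult_right[OF has_derivative_compose[OF this DERIV_exp[unfolded has_field_derivative_def]], of a]
  show ?thesis
    by (simp add: character_def cis_conv_exp mult_ac)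
qed

lemma partial_character:
  "partial i (\<lambda>x. a * character k x) = (\<lambda>x. (a * (\<i> * of_real (2 * pi * of_int (k $ i)))) * character k x)"
  unfolding partial_def
  by (simp add: fun_eq_iff frechet_derivative_at[OF has_derivative_character, symmetric] inner_axis real_vec_def)

text \<open>Multiples of a fixed character are closed under partial derivatives, so every iterated
  derivative has the form treated in \<open>has_derivative_character\<close>.\<close>

lemma partials_character: "\<exists>b. partials js (\<lambda>x. a * character k x) = (\<lambda>x. b * character k x)"
  by (induction js) (auto simp: partials_def partial_character)

lemma inner_real_vec: "real_vec k \<bullet> real_vec l = of_int (\<Sum>i\<in>UNIV. k $ i * l $ i)"
  by (simp add: inner_vec_def real_vec_def)

lemma character_periodic: "character k (x + real_vec l) = character k x"
  using cis_multiple_2pi[of "of_int (\<Sum>i\<in>UNIV. k $ i * l $ i)"]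
  by (simp add: character_def inner_real_vec inner_add_right distrib_left del: of_int_sum flip: cis_mult)

text \<open>Linearity of distributions, and agreement with a representing function, are only known
  on test functions; this makes both available for Fourier coefficients.\<close>

lemma character_in_test_functions: "character k \<in> test_functions"
proof -
  have "partials js (character k) differentiable (at x)" for js x
  proof -
    obtain b where "partials js (character k) = (\<lambda>x. b * character k x)"
      using partials_character[of js 1 k] by auto
    then show ?thesis
      using has_derivative_character[of b k x] unfolding differentiable_def by auto
  qed
  then show ?thesis
    by (simp add: test_functions_def character_periodic)
qed

lemma continuous_test_function:
  assumes "g \<in> test_functions"
  shows "continuous_on UNIV g"
proof -
  have "partials [] g differentiable (at x)" for x
    using assms unfolding test_functions_def by blast
  then show ?thesis
    by (simp add: partials_def continuous_on_eq_continuous_at differentiable_imp_continuous_within)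
qed

text \<open>Characters are eigenfunctions: the phase along the directions \<open>v i\<close> is a
  product over \<open>i\<close>, and Fubini leaves one-dimensional integrals of integer frequencies,
  each equal to 0 or 1.\<close>

lemma radon_fun_character:
  "radon_fun d v (character k) x
    = (if \<forall>i<d. (\<Sum>j\<in>UNIV. k $ j * v i $ j) = 0 then 1 else 0) * character k x"
proof -
  let ?I = "restrict_space lborel {0..1 :: real}"
  have "finite_measure ?I"
    by (rule finite_measureI) (simp add: emeasure_restrict_space)
  then interpret product_sigma_finite "\<lambda>_ :: nat. ?I"
    unfolding product_sigma_finite_def by (auto dest: finite_measure.axioms)
  define m where "m i = (\<Sum>j\<in>UNIV. k $ j * v i $ j)" for i
  have "character k (x + (\<Sum>i<d. t i *\<^sub>R real_vec (v i)))
      = character k x * (\<Prod>i<d. cis (2 * pi * of_int (m i) * t i))" for t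
  proof -
    have "(\<Prod>i<d. cis (2 * pi * of_int (m i) * t i)) = cis (\<Sum>i<d. 2 * pi * of_int (m i) * t i)"
      by (simp add: cis_conv_exp exp_sum sum_distrib_left)
    then show ?thesis
      by (simp add: character_def inner_add_right inner_sum_right inner_real_vec m_def cis_mult
          sum_distrib_left algebra_simps)
  qed
  then have "radon_fun d v (character k) x
      = (LINT t|(\<Pi>\<^sub>M i\<in>{..<d}. ?I). character k x * (\<Prod>i<d. cis (2 * pi * of_int (m i) * t i)))"
    by (simp add: radon_fun_def)
  also have "\<dots> = character k x * (LINT t|(\<Pi>\<^sub>M i\<in>{..<d}. ?I). (\<Prod>i<d. cis (2 * pi * of_int (m i) * t i)))"
    by simp
  also have "(LINT t|(\<Pi>\<^sub>M i\<in>{..<d}. ?I). (\<Prod>i<d. cis (2 * pi * of_int (m i) * t i)))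
      = (\<Prod>i<d. (LINT t|?I. cis (2 * pi * of_int (m i) * t)))"
  proof (rule product_integral_prod)
    show "integrable ?I (\<lambda>t. cis (2 * pi * of_int (m i) * t))" for i
      by (subst integrable_restrict_space)
        (auto intro!: borel_integrable_atLeastAtMost' continuous_intros simp: cis_conv_exp
          simp flip: set_integrable_def)
  qed simp
  also have "\<dots> = (\<Prod>i<d. if m i = 0 then 1 else 0)"
    by (simp add: integral_restrict_space integral_cis_unit_interval)
  also have "\<dots> = (if \<forall>i<d. m i = 0 then 1 else 0)"
    by (auto simp: prod_zero_iff)
  finally show ?thesis by (simp add: m_def mult.commute)
qed

text \<open>The product with \<open>k\<close> is linear over the rationals, so orthogonality may be
  tested on a basis. Thus the eigenvalue in \<open>radon_fun_character\<close> depends on the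
  subspace \<open>A\<close> only and not on the basis chosen in \<open>radon\<close>.\<close>

lemma perp_integer_basis:
  fixes A :: "(rat ^ 'n) set"
  assumes "integer_basis d v A"
  shows "perp k A \<longleftrightarrow> (\<forall>i<d. (\<Sum>j\<in>UNIV. k $ j * v i $ j) = 0)"
proof -
  let ?P = "\<lambda>x :: rat ^ 'n. (\<Sum>j\<in>UNIV. of_int (k $ j) * x $ j) = 0"
  have A: "A = vec.span ((\<lambda>i. rat_vec (v i)) ` {..<d})"
    using assms by (simp add: integer_basis_def)
  have P: "?P (rat_vec (v i)) \<longleftrightarrow> (\<Sum>j\<in>UNIV. k $ j * v i $ j) = 0" for i
  proof -
    have "(\<Sum>j\<in>UNIV. of_int (k $ j) * rat_vec (v i) $ j) = (of_int (\<Sum>j\<in>UNIV. k $ j * v i $ j) :: rat)"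
      by (simp add: rat_vec_def)
    then show ?thesis by (simp only: of_int_eq_0_iff)
  qed
  have "vec.subspace {x. ?P x}"
    by (auto simp: vec.subspace_def distrib_left sum.distrib mult.left_commute
        simp flip: sum_distrib_left)
  then have "A \<subseteq> {x. ?P x}" if "\<forall>i<d. ?P (rat_vec (v i))"
    unfolding A using that by (intro vec.span_minimal) auto
  then have "\<forall>x\<in>A. ?P x" if "\<forall>i<d. ?P (rat_vec (v i))"
    using that by blast
  moreover have "rat_vec (v i) \<in> A" if "i < d" for i
    unfolding A using that by (intro vec.span_base) auto
  ultimately have "(\<forall>x\<in>A. ?P x) \<longleftrightarrow> (\<forall>i<d. ?P (rat_vec (v i)))"
    by blast
  then show ?thesis
    unfolding perp_def P .
qed

text \<open>The eigenvalue leaves the pairing by homogeneity of \<open>f\<close>. The coefficient at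
  \<open>k\<close> tests against the character of \<open>- k\<close>, and orthogonality to
  \<open>A\<close> is unchanged by the sign.\<close>

lemma fourier_radon:
  assumes f: "f \<in> distributions" and A: "A \<in> Gr d"
  shows "fourier (radon d f A) k = (if perp k A then fourier f k else 0)"
proof -
  define v where "v = (SOME v. integer_basis d v A)"
  have v: "integer_basis d v A"
    unfolding v_def using integer_basis_exists[OF A] by (rule someI_ex)
  have neg: "perp (- k) A \<longleftrightarrow> perp k A"
    by (simp add: perp_def sum_negf)
  have "fourier (radon d f A) k = f (radon_fun d v (character (- k)))"
    by (simp add: fourier_def radon_def radon_vectors_def v_def)
  also have "radon_fun d v (character (- k)) = (\<lambda>x. (if perp k A then 1 else 0) * character (- k) x)"
    using perp_integer_basis[OF v, of "- k"] neg by (simp add: fun_eq_iff radon_fun_character)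
  also have "f \<dots> = (if perp k A then 1 else 0) * f (character (- k))"
    using f character_in_test_functions unfolding distributions_def by blast
  finally show ?thesis by (simp add: fourier_def)
qed

section \<open>Fourier series with square summable coefficients\<close>

text \<open>Fatou's lemma: a bound that eventually holds along a sequence survives almost everywhere
  convergence.\<close>

lemma nn_integral_cmod_powr_Fatou:
  fixes f :: "nat \<Rightarrow> 'a \<Rightarrow> complex"
  assumes [measurable]: "\<And>n. f n \<in> borel_measurable M" "h \<in> borel_measurable M"
    and lim: "AE x in M. (\<lambda>n. f n x) \<longlonglongrightarrow> h x" and q: "0 < q"
    and le: "\<forall>\<^sub>F n in sequentially. (\<integral>\<^sup>+ x. ennreal (cmod (f n x) powr q) \<partial>M) \<le> K"
  shows "(\<integral>\<^sup>+ x. ennreal (cmod (h x) powr q) \<partial>M) \<le> K"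
proof -
  have "AE x in M. ennreal (cmod (h x) powr q) \<le> liminf (\<lambda>n. ennreal (cmod (f n x) powr q))"
    using lim
  proof eventually_elim
    case (elim x)
    then have "(\<lambda>n. ennreal (cmod (f n x) powr q)) \<longlonglongrightarrow> ennreal (cmod (h x) powr q)"
      using q by (intro tendsto_ennrealI tendsto_powr' tendsto_norm tendsto_const) auto
    from lim_imp_Liminf[OF sequentially_bot this] show ?case by simp
  qed
  then have "(\<integral>\<^sup>+ x. ennreal (cmod (h x) powr q) \<partial>M)
      \<le> (\<integral>\<^sup>+ x. liminf (\<lambda>n. ennreal (cmod (f n x) powr q)) \<partial>M)"
    by (rule nn_integral_mono_AE)
  also have "\<dots> \<le> liminf (\<lambda>n. \<integral>\<^sup>+ x. ennreal (cmod (f n x) powr q) \<partial>M)"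
    by (rule nn_integral_liminf) measurable
  also have "\<dots> \<le> limsup (\<lambda>n. \<integral>\<^sup>+ x. ennreal (cmod (f n x) powr q) \<partial>M)"
    by (rule Liminf_le_Limsup) simp
  also have "\<dots> \<le> K"
    by (rule Limsup_bounded) (rule le)
  finally show ?thesis .
qed

text \<open>Parseval's identity and the inclusion of L^2 in L^1 on a probability space; this yields
  the Cauchy property of partial sums in L^1.\<close>

lemma integral_cmod_trig_le:
  fixes c :: "int ^ 'n \<Rightarrow> complex"
  assumes "finite F"
  shows "(LINT x|torus. cmod (trig F c x)) \<le> sqrt (\<Sum>k\<in>F. (cmod (c k))\<^sup>2)"
proof -
  let ?S = "\<Sum>k\<in>F. (cmod (c k))\<^sup>2"
  have S: "0 \<le> ?S" by (simp add: sum_nonneg)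
  have "Lp_norm_fun 2 (trig F c) \<le> ennreal (sqrt ?S)"
    using nn_integral_cmod_trig_square[OF assms, of c] S by (subst Lp_norm_fun_le_iff) simp_all
  then have "Lp_norm_fun 1 (trig F c) \<le> ennreal (sqrt ?S)"
    by (rule order_trans[rotated]) (intro Lp_norm_fun_mono measurable_trig, simp_all)
  then have "(\<integral>\<^sup>+ x. ennreal (cmod (trig F c x)) \<partial>torus) \<le> ennreal (sqrt ?S)"
    using S by (simp add: Lp_norm_fun_le_iff)
  moreover have "integrable torus (\<lambda>x. cmod (trig F c x))"
    by (intro integrable_norm continuous_imp_integrable_torus continuous_intros)
  ultimately show ?thesis
    using S by (simp add: nn_integral_eq_integral)
qed

text \<open>Riesz-Fischer: partial sums along an enumeration of the frequencies are Cauchy in L^1,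
  so a subsequence converges almost everywhere. Convergence in L^1 gives the pairings with
  continuous functions, and the filter statement on \<open>F\<close> lets unconditional sums be
  evaluated along the same sets.\<close>

lemma L2_series_converges:
  fixes c :: "int ^ 'n \<Rightarrow> complex"
  assumes c: "(\<lambda>k. (cmod (c k))\<^sup>2) summable_on UNIV"
  obtains h F where "integrable torus h" "\<And>n :: nat. finite (F n)"
    "filterlim F (finite_subsets_at_top UNIV) sequentially"
    "AE x in torus. (\<lambda>n. trig (F n) c x) \<longlonglongrightarrow> h x"
    "\<And>g. continuous_on UNIV g \<Longrightarrow> (\<lambda>n. LINT x|torus. trig (F n) c x * g x) \<longlonglongrightarrow> (LINT x|torus. h x * g x)"
proof -
  define F where "F n = {k :: int ^ 'n. to_nat k < n}" for n
  have fin: "finite (F n)" for n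
    using finite_vimageI[of "{..<n}" "to_nat :: int ^ 'n \<Rightarrow> nat"] by (simp add: F_def vimage_def)
  have mono: "F m \<subseteq> F n" if "m \<le> n" for m n
    using that by (auto simp: F_def)
  have F: "filterlim F (finite_subsets_at_top UNIV) sequentially"
    unfolding filterlim_finite_subsets_at_top
  proof safe
    fix X :: "(int ^ 'n) set" assume "finite X"
    then have "X \<subseteq> F n" if "Suc (Max (insert 0 (to_nat ` X))) \<le> n" for n
      using that by (auto simp: F_def Suc_le_eq intro: le_less_trans[rotated])
    then show "\<forall>\<^sub>F n in sequentially. finite (F n) \<and> X \<subseteq> F n \<and> F n \<subseteq> UNIV"
      using fin unfolding eventually_sequentially by blast
  qed
  define T where "T n = (\<Sum>k\<in>F n. (cmod (c k))\<^sup>2)" for n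
  define s where "s n = trig (F n) c" for n
  have int_s: "integrable torus (s n)" for n
    unfolding s_def by (intro continuous_imp_integrable_torus continuous_intros)
  have meas_s [measurable]: "s n \<in> borel_measurable torus" for n
    unfolding s_def by measurable
  have "(\<lambda>n. T n) \<longlonglongrightarrow> (\<Sum>\<^sub>\<infinity>k. (cmod (c k))\<^sup>2)"
    unfolding T_def using filterlim_compose[OF has_sum_infsum[OF c, unfolded has_sum_def] F] .
  then have Cauchy_T: "Cauchy T"
    by (rule LIMSEQ_imp_Cauchy)
  have diff: "(LINT x|torus. cmod (s i x - s j x)) \<le> sqrt \<bar>T i - T j\<bar>" for i j
  proof -
    have *: "(LINT x|torus. cmod (s i x - s j x)) \<le> sqrt \<bar>T i - T j\<bar>" if "j \<le> i" for i j
    proof -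
      have "s i x - s j x = trig (F i - F j) c x" for x
        unfolding s_def trig_def by (rule sum_diff[symmetric]) (use fin mono that in auto)
      moreover have "T i - T j = (\<Sum>k\<in>F i - F j. (cmod (c k))\<^sup>2)"
        unfolding T_def by (rule sum_diff[symmetric]) (use fin mono that in auto)
      ultimately show ?thesis
        using integral_cmod_trig_le[of "F i - F j" c] fin by (simp add: sum_nonneg)
    qed
    show ?thesis
      using *[of i j] *[of j i] by (cases "i \<le> j") (simp_all add: norm_minus_commute abs_minus_commute)
  qed
  have Cauchy_s: "\<exists>N. \<forall>i\<ge>N. \<forall>j\<ge>N. (LINT x|torus. cmod (s i x - s j x)) < e" if "0 < e" for e
  proof -
    obtain N where N: "\<And>i j. N \<le> i \<Longrightarrow> N \<le> j \<Longrightarrow> \<bar>T i - T j\<bar> < e\<^sup>2"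
      using metric_CauchyD[OF Cauchy_T zero_less_power[OF \<open>0 < e\<close>, of 2]] unfolding dist_real_def by blast
    have "(LINT x|torus. cmod (s i x - s j x)) < e" if "N \<le> i" "N \<le> j" for i j
      using le_less_trans[OF diff real_less_lsqrt[of e "\<bar>T i - T j\<bar>"]] N[OF that] \<open>0 < e\<close> by simp
    then show ?thesis by blast
  qed
  obtain r where r: "strict_mono r" "AE x in torus. Cauchy (\<lambda>i. s (r i) x)"
    using cauchy_L1_AE_cauchy_subseq[of torus s, OF int_s] Cauchy_s by blast
  \<comment> \<open>Off the set of convergence the value is irrelevant; taking \<open>lim\<close>
    keeps \<open>h\<close> measurable.\<close>
  define h where "h x = lim (\<lambda>i. s (r i) x)" for x
  have h [measurable]: "h \<in> borel_measurable torus"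
    unfolding h_def by measurable
  have AE_h: "AE x in torus. (\<lambda>i. s (r i) x) \<longlonglongrightarrow> h x"
    using r(2) by eventually_elim (auto simp: h_def Cauchy_convergent_iff convergent_LIMSEQ_iff)
  \<comment> \<open>With \<open>j\<close> fixed, Fatou's lemma in the other index of the Cauchy
    condition turns almost everywhere convergence into convergence in L^1.\<close>
  have L1: "\<exists>N. \<forall>j\<ge>N. (\<integral>\<^sup>+ x. ennreal (cmod (h x - s (r j) x)) \<partial>torus) \<le> ennreal e" if "0 < e" for e
  proof -
    obtain N where N: "\<And>i j. N \<le> i \<Longrightarrow> N \<le> j \<Longrightarrow> (LINT x|torus. cmod (s i x - s j x)) < e"
      using Cauchy_s[OF \<open>0 < e\<close>] by blast
    have "(\<integral>\<^sup>+ x. ennreal (cmod (h x - s (r j) x) powr 1) \<partial>torus) \<le> ennreal e" if "N \<le> j" for j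
    proof (rule nn_integral_cmod_powr_Fatou[where f = "\<lambda>n x. s (r n) x - s (r j) x"])
      show "AE x in torus. (\<lambda>n. s (r n) x - s (r j) x) \<longlonglongrightarrow> h x - s (r j) x"
        using AE_h by eventually_elim (intro tendsto_intros)
      have "(\<integral>\<^sup>+ x. ennreal (cmod (s (r n) x - s (r j) x) powr 1) \<partial>torus) \<le> ennreal e" if "N \<le> n" for n
      proof -
        have "N \<le> r n" "N \<le> r j"
          using seq_suble[OF r(1), of n] seq_suble[OF r(1), of j] that \<open>N \<le> j\<close> by linarith+
        then have "(LINT x|torus. cmod (s (r n) x - s (r j) x)) < e" by (rule N)
        moreover have "integrable torus (\<lambda>x. cmod (s (r n) x - s (r j) x))"
          by (intro integrable_norm Bochner_Integration.integrable_diff int_s)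
        ultimately show ?thesis
          by (simp add: nn_integral_eq_integral ennreal_leI)
      qed
      then show "\<forall>\<^sub>F n in sequentially.
          (\<integral>\<^sup>+ x. ennreal (cmod (s (r n) x - s (r j) x) powr 1) \<partial>torus) \<le> ennreal e"
        unfolding eventually_sequentially by blast
    qed simp_all
    then show ?thesis by auto
  qed
  have int_h: "integrable torus h"
  proof -
    obtain j where "(\<integral>\<^sup>+ x. ennreal (cmod (h x - s (r j) x)) \<partial>torus) \<le> ennreal 1"
      using L1[of 1] by auto
    then have "integrable torus (\<lambda>x. h x - s (r j) x)"
      by (intro integrableI_bounded) (auto simp: le_less_trans)
    from Bochner_Integration.integrable_add[OF this int_s[of "r j"]] show ?thesis by simp
  qed
  have int_d: "integrable torus (\<lambda>x. h x - s (r j) x)" for j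
    by (intro Bochner_Integration.integrable_diff int_h int_s)
  have d: "(\<lambda>j. LINT x|torus. cmod (h x - s (r j) x)) \<longlonglongrightarrow> 0"
  proof (rule LIMSEQ_I)
    fix e :: real assume "0 < e"
    then obtain N where N: "\<And>j. N \<le> j \<Longrightarrow> (\<integral>\<^sup>+ x. ennreal (cmod (h x - s (r j) x)) \<partial>torus) \<le> ennreal (e / 2)"
      using L1[of "e / 2"] by auto
    have "(LINT x|torus. cmod (h x - s (r j) x)) \<le> e / 2" if "N \<le> j" for j
      using N[OF that] \<open>0 < e\<close> by (simp add: nn_integral_eq_integral integrable_norm int_d)
    then show "\<exists>N. \<forall>j\<ge>N. norm ((LINT x|torus. cmod (h x - s (r j) x)) - 0) < e"
      using \<open>0 < e\<close> by (intro exI[of _ N]) fastforce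
  qed
  show ?thesis
  proof
    show "integrable torus h" by fact
    show "finite (F (r n))" for n by (rule fin)
    show "filterlim (\<lambda>n. F (r n)) (finite_subsets_at_top UNIV) sequentially"
      by (rule filterlim_compose[OF F filterlim_subseq[OF r(1)]])
    show "AE x in torus. (\<lambda>n. trig (F (r n)) c x) \<longlonglongrightarrow> h x"
      using AE_h by (simp add: s_def)
    fix g :: "real ^ 'n \<Rightarrow> complex" assume g: "continuous_on UNIV g"
    have "compact (g ` cbox 0 1)"
      by (intro compact_continuous_image continuous_on_subset[OF g]) auto
    then obtain B where B: "\<And>x. x \<in> cbox 0 1 \<Longrightarrow> cmod (g x) \<le> B"
      by (auto simp: compact_eq_bounded_closed bounded_iff)
    have "cmod ((LINT x|torus. h x * g x) - (LINT x|torus. s (r n) x * g x))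
        \<le> B * (LINT x|torus. cmod (h x - s (r n) x))" for n
    proof -
      have "(LINT x|torus. h x * g x) - (LINT x|torus. s (r n) x * g x)
          = (LINT x|torus. (h x - s (r n) x) * g x)"
        by (subst Bochner_Integration.integral_diff[symmetric])
          (simp_all add: integrable_mult_bounded_torus int_h int_s g left_diff_distrib)
      also have "cmod \<dots> \<le> (LINT x|torus. cmod ((h x - s (r n) x) * g x))"
        by (rule integral_norm_bound)
      also have "\<dots> \<le> (LINT x|torus. B * cmod (h x - s (r n) x))"
        using B by (intro integral_mono integrable_norm integrable_mult_bounded_torus int_d g integrable_mult_right)
          (simp_all add: norm_mult mult.commute mult_right_mono)
      finally show ?thesis by simp
    qed
    moreover have "(\<lambda>n. B * (LINT x|torus. cmod (h x - s (r n) x))) \<longlonglongrightarrow> 0"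
      using tendsto_mult_right_zero[OF d] .
    ultimately have "(\<lambda>n. (LINT x|torus. h x * g x) - (LINT x|torus. s (r n) x * g x)) \<longlonglongrightarrow> 0"
      by (rule Lim_null_comparison[OF always_eventually[OF allI]])
    from tendsto_diff[OF tendsto_const[of "LINT x|torus. h x * g x"] this]
    show "(\<lambda>n. LINT x|torus. trig (F (r n)) c x * g x) \<longlonglongrightarrow> (LINT x|torus. h x * g x)"
      by (simp add: s_def)
  qed
qed

section \<open>Multipliers represented by functions, and the two embeddings for functionals\<close>

lemma ennreal_sum_le_infsum: "finite F \<Longrightarrow> sum f F \<le> (\<Sum>\<^sub>\<infinity>k. f k :: ennreal)"
  by (subst nonneg_infsum_complete) (auto intro: SUP_upper)

lemma ennreal_infsum_le:
  assumes "\<And>F. finite F \<Longrightarrow> F \<subseteq> A \<Longrightarrow> sum f F \<le> (b :: ennreal)"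
  shows "(\<Sum>\<^sub>\<infinity>k\<in>A. f k) \<le> b"
  using assms by (subst nonneg_infsum_complete) (auto intro: SUP_least)

text \<open>An infinite sum that does not converge has the default value 0, so the series defining a
  multiplier must be shown summable. Both factors are square summable, that of \<open>g\<close> by
  Bessel's inequality.\<close>

lemma summable_fourier_pairing:
  fixes c :: "int ^ 'n \<Rightarrow> complex"
  assumes c: "(\<lambda>k. (cmod (c k))\<^sup>2) summable_on UNIV" and g: "continuous_on UNIV g"
  shows "(\<lambda>k. c k * fourier (dist_of_fun g) (- k)) summable_on UNIV"
proof -
  have gint: "integrable torus g" by (intro continuous_imp_integrable_torus g)
  have "integrable torus (\<lambda>x. g x * cnj (g x))"
    by (intro continuous_imp_integrable_torus continuous_intros g)
  then have "(\<integral>\<^sup>+ x. ennreal (cmod (g x * cnj (g x))) \<partial>torus) < top"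
    by (simp add: integrable_iff_bounded)
  then have "(\<integral>\<^sup>+ x. ennreal (cmod (g x) powr 2) \<partial>torus) < top"
    by (simp add: norm_mult power2_eq_square)
  then have "Lp_norm_fun 2 g < top"
    by (auto simp: Lp_norm_fun_def ennreal_powr_def)
  then obtain B where B: "0 \<le> B" "Lp_norm_fun 2 g = ennreal B"
    by (cases "Lp_norm_fun 2 g") auto
  \<comment> \<open>At p = 2 the Sobolev exponent is zero, and \<open>dual_sobolev_fun\<close>
    becomes Bessel's inequality up to a constant.\<close>
  have "(1 :: real) < 2" "(2 :: real) \<le> 2" by simp_all
  from dual_sobolev_fun[OF this, where 'n = 'n] gint B(1) eq_refl[OF B(2)]
  obtain C where "\<And>F. finite F \<Longrightarrow>
      (\<Sum>k\<in>F. bracket k powr - (2 * sobolev_exponent TYPE('n) 2) * (cmod (fourier (dist_of_fun g) k))\<^sup>2) \<le> (C * B)\<^sup>2"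
    by blast
  then have bessel: "(\<Sum>k\<in>F. (cmod (fourier (dist_of_fun g) k))\<^sup>2) \<le> (C * B)\<^sup>2" if "finite F" for F
    using that by (simp add: sobolev_exponent_def less_imp_neq[OF bracket_pos, symmetric])
  have "(\<lambda>k. cmod (c k * fourier (dist_of_fun g) (- k))) summable_on UNIV"
  proof (rule nonneg_bounded_partial_sums_imp_summable_on)
    have "(\<Sum>k\<in>F. cmod (c k * fourier (dist_of_fun g) (- k))) \<le> (\<Sum>\<^sub>\<infinity>k. (cmod (c k))\<^sup>2) + (C * B)\<^sup>2"
      if "finite F" for F
    proof -
      have "(\<Sum>k\<in>F. cmod (c k * fourier (dist_of_fun g) (- k)))
          \<le> (\<Sum>k\<in>F. (cmod (c k))\<^sup>2 + (cmod (fourier (dist_of_fun g) (- k)))\<^sup>2)"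
      proof (intro sum_mono)
        fix k
        show "cmod (c k * fourier (dist_of_fun g) (- k)) \<le> (cmod (c k))\<^sup>2 + (cmod (fourier (dist_of_fun g) (- k)))\<^sup>2"
          using sum_squares_bound[of "cmod (c k)" "cmod (fourier (dist_of_fun g) (- k))"]
            mult_nonneg_nonneg[OF norm_ge_zero norm_ge_zero, of "c k" "fourier (dist_of_fun g) (- k)"]
          unfolding norm_mult by (simp only: mult.assoc)
      qed
      also have "\<dots> = (\<Sum>k\<in>F. (cmod (c k))\<^sup>2) + (\<Sum>k\<in>uminus ` F. (cmod (fourier (dist_of_fun g) k))\<^sup>2)"
        by (simp add: sum.distrib sum.reindex)
      also have "\<dots> \<le> (\<Sum>\<^sub>\<infinity>k. (cmod (c k))\<^sup>2) + (C * B)\<^sup>2"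
        using that by (intro add_mono bessel finite_sum_le_infsum c) auto
      finally show ?thesis .
    qed
    then show "\<forall>\<^sub>F F in finite_subsets_at_top UNIV.
        (\<Sum>k\<in>F. cmod (c k * fourier (dist_of_fun g) (- k))) \<le> (\<Sum>\<^sub>\<infinity>k. (cmod (c k))\<^sup>2) + (C * B)\<^sup>2"
      by (intro eventually_finite_subsets_at_top_weakI) auto
  qed simp
  then show ?thesis by (rule abs_summable_summable)
qed

text \<open>Along the sets \<open>F n\<close> the pairings of the partial sums with \<open>g\<close>
  tend both to the multiplier's value and to the integral against the Riesz-Fischer limit.\<close>

lemma multiplier_eq_dist_of_fun:
  assumes c: "(\<lambda>k. (cmod (fourier (multiplier \<omega> u) k))\<^sup>2) summable_on (UNIV :: (int ^ 'n) set)"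
  obtains h F where "integrable torus h" "\<And>g. g \<in> test_functions \<Longrightarrow> multiplier \<omega> u g = dist_of_fun h g"
    "\<And>n :: nat. finite (F n)"
    "AE x in torus. (\<lambda>n. trig (F n) (fourier (multiplier \<omega> u)) x) \<longlonglongrightarrow> h x"
proof -
  define c where "c = fourier (multiplier \<omega> u)"
  from c obtain h and F :: "nat \<Rightarrow> (int ^ 'n) set" where h: "integrable torus h" "\<And>n. finite (F n)"
    "filterlim F (finite_subsets_at_top UNIV) sequentially"
    "AE x in torus. (\<lambda>n. trig (F n) c x) \<longlonglongrightarrow> h x"
    "\<And>g. continuous_on UNIV g \<Longrightarrow> (\<lambda>n. LINT x|torus. trig (F n) c x * g x) \<longlonglongrightarrow> (LINT x|torus. h x * g x)"
    unfolding c_def[symmetric] by (rule L2_series_converges) blast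
  have "multiplier \<omega> u g = dist_of_fun h g" if "g \<in> test_functions" for g
  proof -
    have g: "continuous_on UNIV g" using that by (rule continuous_test_function)
    have "((\<lambda>k. c k * fourier (dist_of_fun g) (- k)) has_sum multiplier \<omega> u g) UNIV"
      using has_sum_infsum[OF summable_fourier_pairing[OF _ g, of c]] c
      by (simp add: multiplier_def c_def fourier_multiplier)
    then have "(\<lambda>n. \<Sum>k\<in>F n. c k * fourier (dist_of_fun g) (- k)) \<longlonglongrightarrow> multiplier \<omega> u g"
      unfolding has_sum_def by (rule filterlim_compose[OF _ h(3)])
    moreover have "(\<Sum>k\<in>F n. c k * fourier (dist_of_fun g) (- k)) = (LINT x|torus. trig (F n) c x * g x)" for n
      using integral_mult_trig[OF continuous_imp_integrable_torus[OF g]] by (simp add: mult.commute)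
    ultimately show ?thesis
      using h(5)[OF g] by (auto simp: dist_of_fun_def intro: LIMSEQ_unique)
  qed
  with h show ?thesis
    using that unfolding c_def by blast
qed

text \<open>A finite right-hand side makes the coefficients square summable, the weights being at
  least 1, and so provides a representing function; Fatou carries \<open>trig_sobolev\<close> over
  to it. Multipliers are determined by their Fourier coefficients, unlike arbitrary functionals
  \<open>u\<close>.\<close>

lemma Lp_norm_multiplier_le:
  assumes q: "2 \<le> q"
  shows "\<exists>C>0. \<forall>(\<omega> :: int ^ 'n \<Rightarrow> real) u. (Lp_norm q (multiplier \<omega> u))\<^sup>2
    \<le> ennreal (C\<^sup>2) * (\<Sum>\<^sub>\<infinity>k. ennreal (bracket k powr (2 * sobolev_exponent TYPE('n) q) * (cmod (fourier (multiplier \<omega> u) k))\<^sup>2))"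
proof -
  define \<sigma> where "\<sigma> = 2 * sobolev_exponent TYPE('n) q"
  have \<sigma>: "0 \<le> \<sigma>" by (simp add: \<sigma>_def sobolev_exponent_def)
  obtain C where C: "0 < C" "\<And>(F :: (int ^ 'n) set) c. finite F \<Longrightarrow>
    (\<integral>\<^sup>+ x. ennreal (cmod (trig F c x) powr q) \<partial>torus)
      \<le> ennreal ((C * sqrt (\<Sum>k\<in>F. bracket k powr \<sigma> * (cmod (c k))\<^sup>2)) powr q)"
    using trig_sobolev[OF q, where 'n = 'n] unfolding \<sigma>_def by blast
  show ?thesis
    unfolding \<sigma>_def[symmetric]
  proof (intro exI[of _ C] conjI C(1) allI)
    fix \<omega> :: "int ^ 'n \<Rightarrow> real" and u
    define c where "c = fourier (multiplier \<omega> u)"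
    define S where "S = (\<Sum>\<^sub>\<infinity>k. ennreal (bracket k powr \<sigma> * (cmod (c k))\<^sup>2))"
    have "(Lp_norm q (multiplier \<omega> u))\<^sup>2 \<le> ennreal (C\<^sup>2) * S"
    proof (cases S)
      case (real R)
      have sum_le: "(\<Sum>k\<in>F. bracket k powr \<sigma> * (cmod (c k))\<^sup>2) \<le> R" if "finite F" for F
        using ennreal_sum_le_infsum[OF that, of "\<lambda>k. ennreal (bracket k powr \<sigma> * (cmod (c k))\<^sup>2)"] real
        by (simp add: sum_ennreal flip: S_def)
      have "(\<lambda>k. (cmod (c k))\<^sup>2) summable_on UNIV"
      proof (rule nonneg_bounded_partial_sums_imp_summable_on)
        have "(\<Sum>k\<in>F. (cmod (c k))\<^sup>2) \<le> R" if "finite F" for F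
        proof -
          have "(\<Sum>k\<in>F. 1 * (cmod (c k))\<^sup>2) \<le> (\<Sum>k\<in>F. bracket k powr \<sigma> * (cmod (c k))\<^sup>2)"
            using ge_one_powr_ge_zero[OF bracket_ge_1 \<sigma>] by (intro sum_mono mult_right_mono) auto
          then show ?thesis using sum_le[OF that] by simp
        qed
        then show "\<forall>\<^sub>F F in finite_subsets_at_top UNIV. (\<Sum>k\<in>F. (cmod (c k))\<^sup>2) \<le> R"
          by (intro eventually_finite_subsets_at_top_weakI) auto
      qed simp
      then obtain h and F :: "nat \<Rightarrow> (int ^ 'n) set" where h: "integrable torus h"
        "\<And>g. g \<in> test_functions \<Longrightarrow> multiplier \<omega> u g = dist_of_fun h g"
        "\<And>n. finite (F n)" "AE x in torus. (\<lambda>n. trig (F n) c x) \<longlonglongrightarrow> h x"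
        unfolding c_def by (rule multiplier_eq_dist_of_fun) blast
      have "(\<integral>\<^sup>+ x. ennreal (cmod (h x) powr q) \<partial>torus) \<le> ennreal ((C * sqrt R) powr q)"
      proof (rule nn_integral_cmod_powr_Fatou[OF _ _ h(4)])
        have "(C * sqrt (\<Sum>k\<in>F n. bracket k powr \<sigma> * (cmod (c k))\<^sup>2)) powr q \<le> (C * sqrt R) powr q" for n
          using C(1) q sum_le[OF h(3)]
          by (intro powr_mono2 mult_left_mono real_sqrt_le_mono mult_nonneg_nonneg real_sqrt_ge_zero sum_nonneg) auto
        then show "\<forall>\<^sub>F n in sequentially.
            (\<integral>\<^sup>+ x. ennreal (cmod (trig (F n) c x) powr q) \<partial>torus) \<le> ennreal ((C * sqrt R) powr q)"
          by (intro always_eventually allI order_trans[OF C(2)[OF h(3)]] ennreal_leI)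
      qed (use h(1) q in auto)
      then have "Lp_norm_fun q h \<le> ennreal (C * sqrt R)"
        using q C(1) real by (subst Lp_norm_fun_le_iff) auto
      moreover have "Lp_norm q (multiplier \<omega> u) \<le> Lp_norm_fun q h"
        unfolding Lp_norm_def using h(1,2) by (intro INF_lower) auto
      ultimately have "(Lp_norm q (multiplier \<omega> u))\<^sup>2 \<le> (ennreal (C * sqrt R))\<^sup>2"
        by (intro power_mono) auto
      also have "\<dots> = ennreal (C\<^sup>2) * S"
        using C(1) real by (simp add: ennreal_power power_mult_distrib flip: ennreal_mult)
      finally show ?thesis .
    qed (use C(1) in \<open>simp add: ennreal_mult_top\<close>)
    then show "(Lp_norm q (multiplier \<omega> u))\<^sup>2
        \<le> ennreal (C\<^sup>2) * (\<Sum>\<^sub>\<infinity>k. ennreal (bracket k powr \<sigma> * (cmod (fourier (multiplier \<omega> u) k))\<^sup>2))"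
      by (simp only: S_def c_def)
  qed
qed

text \<open>The bound of \<open>dual_sobolev_fun\<close> holds for every representing function,
  whose coefficients are those of \<open>u\<close>, and passes to the infimum; without a
  representative the right-hand side is top.\<close>

lemma dual_sobolev:
  assumes "1 < p" "p \<le> 2"
  shows "\<exists>C>0. \<forall>u :: (real ^ 'n \<Rightarrow> complex) \<Rightarrow> complex.
    (\<Sum>\<^sub>\<infinity>k. ennreal (bracket k powr - (2 * sobolev_exponent TYPE('n) p) * (cmod (fourier u k))\<^sup>2))
      \<le> ennreal (C\<^sup>2) * (Lp_norm p u)\<^sup>2"
proof -
  define \<sigma> where "\<sigma> = 2 * sobolev_exponent TYPE('n) p"
  obtain C where C: "0 < C" "\<And>(h :: real ^ 'n \<Rightarrow> complex) B F. integrable torus h \<Longrightarrow> 0 \<le> B \<Longrightarrow> Lp_norm_fun p h \<le> ennreal B \<Longrightarrow> finite F \<Longrightarrow>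
    (\<Sum>k\<in>F. bracket k powr - \<sigma> * (cmod (fourier (dist_of_fun h) k))\<^sup>2) \<le> (C * B)\<^sup>2"
    using dual_sobolev_fun[OF assms, where 'n = 'n] unfolding \<sigma>_def by blast
  show ?thesis
    unfolding \<sigma>_def[symmetric]
  proof (intro exI[of _ C] conjI C(1) allI)
    fix u :: "(real ^ 'n \<Rightarrow> complex) \<Rightarrow> complex"
    define S where "S = (\<Sum>\<^sub>\<infinity>k. ennreal (bracket k powr - \<sigma> * (cmod (fourier u k))\<^sup>2))"
    \<comment> \<open>Dividing by \<open>C\<close> isolates the infimum, so that \<open>Y\<close> is
      compared with each competitor separately.\<close>
    define Y where "Y = ennreal_powr S (1 / 2) / ennreal C"
    have "Y \<le> Lp_norm p u"
      unfolding Lp_norm_def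
    proof (rule INF_greatest)
      fix h assume "h \<in> {h. integrable torus h \<and> (\<forall>g\<in>test_functions. u g = dist_of_fun h g)}"
      then have h: "integrable torus h" and u: "fourier u k = fourier (dist_of_fun h) k" for k
        by (auto simp: fourier_def character_in_test_functions)
      show "Y \<le> Lp_norm_fun p h"
      proof (cases "Lp_norm_fun p h")
        case (real B)
        have "S \<le> ennreal ((C * B)\<^sup>2)"
          unfolding S_def using C(2)[OF h real(1)] real
          by (intro ennreal_infsum_le) (simp add: sum_ennreal u ennreal_leI)
        then have "ennreal_powr S (1 / 2) \<le> ennreal (C * B)"
          using C(1) real by (subst ennreal_powr_le_iff) auto
        then have "Y \<le> ennreal (C * B) / ennreal C"
          unfolding Y_def by (rule divide_right_mono_ennreal)
        also have "\<dots> = Lp_norm_fun p h"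
          using C(1) real by (simp add: divide_ennreal)
        finally show ?thesis .
      qed simp
    qed
    then have "ennreal C * Y \<le> ennreal C * Lp_norm p u"
      by (rule mult_left_mono) simp
    moreover have "ennreal C * Y = ennreal_powr S (1 / 2)"
      using C(1) by (simp add: Y_def ennreal_times_divide mult.commute[of "ennreal C"] mult_divide_eq_ennreal)
    ultimately have "(ennreal_powr S (1 / 2))\<^sup>2 \<le> (ennreal C * Lp_norm p u)\<^sup>2"
      by (intro power_mono) auto
    then show "(\<Sum>\<^sub>\<infinity>k. ennreal (bracket k powr - \<sigma> * (cmod (fourier u k))\<^sup>2)) \<le> ennreal (C\<^sup>2) * (Lp_norm p u)\<^sup>2"
      using C(1) by (simp add: power2_ennreal_powr_half power_mult_distrib ennreal_power flip: S_def)
  qed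
qed

section \<open>Stability of the Radon transform\<close>

lemma ennreal_power2_le_imp_le: "x\<^sup>2 \<le> y\<^sup>2 \<Longrightarrow> x \<le> (y :: ennreal)"
  by (cases x; cases y) (auto simp: ennreal_power top_unique power2_eq_square[of top] intro: power2_le_imp_le)

lemma ennreal_summable_on: "(f :: 'a \<Rightarrow> ennreal) summable_on A"
  by (simp add: nonneg_summable_on_complete)

lemma ennreal_infsum_cmult: "a * (\<Sum>\<^sub>\<infinity>x\<in>A. f x) = (\<Sum>\<^sub>\<infinity>x\<in>A. a * f x :: ennreal)"
  by (simp add: nonneg_infsum_complete SUP_mult_left_ennreal sum_distrib_left)

lemma ennreal_sum_infsum:
  "finite F \<Longrightarrow> (\<Sum>k\<in>F. \<Sum>\<^sub>\<infinity>x\<in>A. f k x) = (\<Sum>\<^sub>\<infinity>x\<in>A. \<Sum>k\<in>F. f k x :: ennreal)"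
  by (induction F rule: finite_induct) (simp_all add: infsum_add ennreal_summable_on)

lemma ennreal_infsum_mono:
  "(\<And>x. x \<in> A \<Longrightarrow> f x \<le> g x) \<Longrightarrow> (\<Sum>\<^sub>\<infinity>x\<in>A. f x :: ennreal) \<le> (\<Sum>\<^sub>\<infinity>x\<in>A. g x)"
  by (intro infsum_mono ennreal_summable_on)

lemma power2_data_norm:
  "(data_norm d w p s G)\<^sup>2 = (\<Sum>\<^sub>\<infinity>A\<in>Gr d. (sobolev_norm p s (multiplier (\<lambda>k. w k A) (G A)))\<^sup>2)"
  by (simp add: data_norm_def power2_ennreal_powr_half)

text \<open>The constant is the same for all functionals, hence for all weighted components, and the
  squares can be summed over \<open>A\<close>.\<close>

lemma data_norm_le:
  assumes "0 < K" "\<And>u. (sobolev_norm p s (u :: (real ^ 'n \<Rightarrow> complex) \<Rightarrow> complex))\<^sup>2 \<le> ennreal (K\<^sup>2) * (sobolev_norm p' s' u)\<^sup>2"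
  shows "data_norm d w p s (G :: (rat ^ 'n) set \<Rightarrow> _) \<le> ennreal K * data_norm d w p' s' G"
proof (rule ennreal_power2_le_imp_le)
  have "(data_norm d w p s G)\<^sup>2 \<le> ennreal (K\<^sup>2) * (data_norm d w p' s' G)\<^sup>2"
    unfolding power2_data_norm ennreal_infsum_cmult by (intro ennreal_infsum_mono assms(2))
  also have "\<dots> = (ennreal K * data_norm d w p' s' G)\<^sup>2"
    using assms(1) by (simp add: power_mult_distrib ennreal_power)
  finally show "(data_norm d w p s G)\<^sup>2 \<le> (ennreal K * data_norm d w p' s' G)\<^sup>2" .
qed

lemma cmod_fourier_multiplier_bracket:
  "(cmod (fourier (multiplier (\<lambda>k. bracket k powr s) u) k))\<^sup>2 = bracket k powr (2 * s) * (cmod (fourier u k))\<^sup>2"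
  by (simp add: fourier_multiplier norm_mult power_mult_distrib powr_power less_imp_neq[OF bracket_pos, symmetric])

text \<open>The L^2 norm is bounded by the coefficients through \<open>Lp_norm_multiplier_le\<close>
  at exponent 2, and the coefficients by the L^p norm through \<open>dual_sobolev\<close>; its
  negative weight cancels the extra smoothness.\<close>

lemma sobolev_embedding:
  assumes "1 < p" "p \<le> 2"
  shows "\<exists>K>0. \<forall>u :: (real ^ 'n \<Rightarrow> complex) \<Rightarrow> complex.
    (sobolev_norm 2 s u)\<^sup>2 \<le> ennreal (K\<^sup>2) * (sobolev_norm p (s + sobolev_exponent TYPE('n) p) u)\<^sup>2"
proof -
  let ?\<sigma> = "sobolev_exponent TYPE('n) p"
  have 0: "sobolev_exponent TYPE('n) 2 = 0" by (simp add: sobolev_exponent_def)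
  obtain C where C: "0 < C" "\<And>(\<omega> :: int ^ 'n \<Rightarrow> real) u. (Lp_norm 2 (multiplier \<omega> u))\<^sup>2
    \<le> ennreal (C\<^sup>2) * (\<Sum>\<^sub>\<infinity>k. ennreal ((cmod (fourier (multiplier \<omega> u) k))\<^sup>2))"
    using Lp_norm_multiplier_le[of 2, where 'n = 'n]
    unfolding 0 by (auto simp: less_imp_neq[OF bracket_pos, symmetric])
  obtain D where D: "0 < D" "\<And>u :: (real ^ 'n \<Rightarrow> complex) \<Rightarrow> complex.
    (\<Sum>\<^sub>\<infinity>k. ennreal (bracket k powr - (2 * ?\<sigma>) * (cmod (fourier u k))\<^sup>2)) \<le> ennreal (D\<^sup>2) * (Lp_norm p u)\<^sup>2"
    using dual_sobolev[OF assms, where 'n = 'n] by blast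
  show ?thesis
  proof (intro exI[of _ "C * D"] conjI allI)
    fix u :: "(real ^ 'n \<Rightarrow> complex) \<Rightarrow> complex"
    have "(sobolev_norm 2 s u)\<^sup>2 \<le> ennreal (C\<^sup>2) * (\<Sum>\<^sub>\<infinity>k. ennreal (bracket k powr (2 * s) * (cmod (fourier u k))\<^sup>2))"
      unfolding sobolev_norm_def using C(2)[of "\<lambda>k. bracket k powr s" u]
      by (simp only: cmod_fourier_multiplier_bracket)
    also have "\<dots> \<le> ennreal (C\<^sup>2) * (ennreal (D\<^sup>2) * (sobolev_norm p (s + ?\<sigma>) u)\<^sup>2)"
    proof (rule mult_left_mono)
      have "bracket k powr - (2 * ?\<sigma>) * (bracket k powr (2 * (s + ?\<sigma>)) * (cmod (fourier u k))\<^sup>2)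
          = bracket k powr (2 * s) * (cmod (fourier u k))\<^sup>2" for k
        by (simp add: mult.assoc[symmetric] distrib_left flip: powr_add)
      then show "(\<Sum>\<^sub>\<infinity>k. ennreal (bracket k powr (2 * s) * (cmod (fourier u k))\<^sup>2))
          \<le> ennreal (D\<^sup>2) * (sobolev_norm p (s + ?\<sigma>) u)\<^sup>2"
        unfolding sobolev_norm_def using D(2)[of "multiplier (\<lambda>k. bracket k powr (s + ?\<sigma>)) u"]
        by (simp only: cmod_fourier_multiplier_bracket)
    qed simp
    finally show "(sobolev_norm 2 s u)\<^sup>2 \<le> ennreal ((C * D)\<^sup>2) * (sobolev_norm p (s + ?\<sigma>) u)\<^sup>2"
      by (simp add: power_mult_distrib ennreal_mult mult.assoc)
  qed (use C D in simp)
qed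

text \<open>Tonelli for nonnegative sums: the lower bound on the weight sum at each \<open>k\<close>
  is spread over the subspaces orthogonal to \<open>k\<close>, and for fixed \<open>A\<close>
  Bessel's inequality bounds the sum over \<open>k\<close>.\<close>

lemma sum_fourier_le_data_norm:
  fixes w :: "int ^ 'n \<Rightarrow> (rat ^ 'n) set \<Rightarrow> real"
  assumes w: "\<And>k. ennreal c \<le> weight_sum d w k"
  shows "\<exists>K>0. \<forall>f\<in>distributions. ennreal c * (\<Sum>\<^sub>\<infinity>k. ennreal (bracket k powr (2 * s) * (cmod (fourier f k))\<^sup>2))
    \<le> ennreal (K\<^sup>2) * (data_norm d w 2 s (radon d f))\<^sup>2"
proof -
  have 0: "sobolev_exponent TYPE('n) 2 = 0" by (simp add: sobolev_exponent_def)
  obtain K where K: "0 < K" "\<And>u :: (real ^ 'n \<Rightarrow> complex) \<Rightarrow> complex.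
    (\<Sum>\<^sub>\<infinity>k. ennreal ((cmod (fourier u k))\<^sup>2)) \<le> ennreal (K\<^sup>2) * (Lp_norm 2 u)\<^sup>2"
    using dual_sobolev[of 2, where 'n = 'n]
    unfolding 0 by (auto simp: less_imp_neq[OF bracket_pos, symmetric])
  show ?thesis
  proof (intro exI[of _ K] conjI K(1) ballI)
    fix f :: "(real ^ 'n \<Rightarrow> complex) \<Rightarrow> complex" assume f: "f \<in> distributions"
    define b where "b k = ennreal (bracket k powr (2 * s) * (cmod (fourier f k))\<^sup>2)" for k
    \<comment> \<open>By \<open>fourier_radon\<close> this is the squared modulus of the coefficient
      at \<open>k\<close> of the weighted and smoothed data at \<open>A\<close>.\<close>
    define t where "t k A = b k * (if perp k A then ennreal ((w k A)\<^sup>2) else 0)" for k A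
    have t: "(\<Sum>\<^sub>\<infinity>k. t k A) \<le> ennreal (K\<^sup>2) * (sobolev_norm 2 s (multiplier (\<lambda>k. w k A) (radon d f A)))\<^sup>2"
      if "A \<in> Gr d" for A
    proof -
      have "t k A = ennreal ((cmod (fourier (multiplier (\<lambda>k. bracket k powr s)
          (multiplier (\<lambda>k. w k A) (radon d f A))) k))\<^sup>2)" for k
        unfolding t_def b_def cmod_fourier_multiplier_bracket
        by (simp add: fourier_multiplier fourier_radon[OF f that] norm_mult power_mult_distrib mult_ac
            flip: ennreal_mult)
      then show ?thesis
        unfolding sobolev_norm_def using K(2) by simp
    qed
    have "ennreal c * (\<Sum>\<^sub>\<infinity>k. b k) \<le> (\<Sum>\<^sub>\<infinity>A\<in>Gr d. \<Sum>\<^sub>\<infinity>k. t k A)"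
      unfolding ennreal_infsum_cmult
    proof (rule ennreal_infsum_le)
      \<comment> \<open>For finitely many frequencies the exchange is mere additivity; afterwards
        each inner sum is enlarged to all frequencies.\<close>
      fix F :: "(int ^ 'n) set" assume F: "finite F"
      have "(\<Sum>k\<in>F. ennreal c * b k) \<le> (\<Sum>k\<in>F. b k * weight_sum d w k)"
        using w by (intro sum_mono) (subst mult.commute, intro mult_left_mono, auto)
      also have "\<dots> = (\<Sum>k\<in>F. \<Sum>\<^sub>\<infinity>A\<in>Gr d. t k A)"
      proof (intro sum.cong refl)
        fix k
        have "weight_sum d w k = (\<Sum>\<^sub>\<infinity>A\<in>Gr d. if perp k A then ennreal ((w k A)\<^sup>2) else 0)"
          unfolding weight_sum_def by (rule infsum_cong_neutral) auto
        then show "b k * weight_sum d w k = (\<Sum>\<^sub>\<infinity>A\<in>Gr d. t k A)"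
          by (simp only: ennreal_infsum_cmult t_def)
      qed
      also have "\<dots> = (\<Sum>\<^sub>\<infinity>A\<in>Gr d. \<Sum>k\<in>F. t k A)"
        by (rule ennreal_sum_infsum) (rule F)
      also have "\<dots> \<le> (\<Sum>\<^sub>\<infinity>A\<in>Gr d. \<Sum>\<^sub>\<infinity>k. t k A)"
        by (intro ennreal_infsum_mono ennreal_sum_le_infsum F)
      finally show "(\<Sum>k\<in>F. ennreal c * b k) \<le> (\<Sum>\<^sub>\<infinity>A\<in>Gr d. \<Sum>\<^sub>\<infinity>k. t k A)" .
    qed
    also have "\<dots> \<le> ennreal (K\<^sup>2) * (data_norm d w 2 s (radon d f))\<^sup>2"
      unfolding power2_data_norm ennreal_infsum_cmult by (intro ennreal_infsum_mono t)
    finally show "ennreal c * (\<Sum>\<^sub>\<infinity>k. ennreal (bracket k powr (2 * s) * (cmod (fourier f k))\<^sup>2))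
        \<le> ennreal (K\<^sup>2) * (data_norm d w 2 s (radon d f))\<^sup>2"
      by (simp only: b_def)
  qed
qed

text \<open>The Sobolev embedding is applied to \<open>f\<close> itself, and the resulting
  coefficient sum is bounded by the L^2 data. At q = 2 there is no shift of smoothness.\<close>

lemma radon_stability:
  fixes w :: "int ^ 'n \<Rightarrow> (rat ^ 'n) set \<Rightarrow> real"
  assumes c: "0 < c" and w: "\<And>k. ennreal (c\<^sup>2) \<le> weight_sum d w k" and q: "2 \<le> q"
  shows "\<exists>K>0. \<forall>f\<in>distributions. sobolev_norm q s f
    \<le> ennreal K * data_norm d w 2 (s + sobolev_exponent TYPE('n) q) (radon d f)"
proof -
  let ?\<sigma> = "sobolev_exponent TYPE('n) q"
  obtain C where C: "0 < C" "\<And>(\<omega> :: int ^ 'n \<Rightarrow> real) u. (Lp_norm q (multiplier \<omega> u))\<^sup>2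
    \<le> ennreal (C\<^sup>2) * (\<Sum>\<^sub>\<infinity>k. ennreal (bracket k powr (2 * ?\<sigma>) * (cmod (fourier (multiplier \<omega> u) k))\<^sup>2))"
    using Lp_norm_multiplier_le[OF q, where 'n = 'n] by blast
  obtain K where K: "0 < K" "\<And>f. f \<in> distributions \<Longrightarrow>
    ennreal (c\<^sup>2) * (\<Sum>\<^sub>\<infinity>k. ennreal (bracket k powr (2 * (s + ?\<sigma>)) * (cmod (fourier f k))\<^sup>2))
      \<le> ennreal (K\<^sup>2) * (data_norm d w 2 (s + ?\<sigma>) (radon d f))\<^sup>2"
    using sum_fourier_le_data_norm[OF w, of "s + ?\<sigma>"] by blast
  show ?thesis
  proof (intro exI[of _ "C / c * K"] conjI ballI)
    fix f :: "(real ^ 'n \<Rightarrow> complex) \<Rightarrow> complex" assume f: "f \<in> distributions"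
    define S where "S = (\<Sum>\<^sub>\<infinity>k. ennreal (bracket k powr (2 * (s + ?\<sigma>)) * (cmod (fourier f k))\<^sup>2))"
    have "bracket k powr (2 * ?\<sigma>) * (bracket k powr (2 * s) * (cmod (fourier f k))\<^sup>2)
        = bracket k powr (2 * (s + ?\<sigma>)) * (cmod (fourier f k))\<^sup>2" for k
      by (simp only: mult.assoc[symmetric] powr_add[symmetric] distrib_left add.commute[of "2 * s"])
    then have "(sobolev_norm q s f)\<^sup>2 \<le> ennreal (C\<^sup>2) * S"
      unfolding sobolev_norm_def S_def using C(2)[of "\<lambda>k. bracket k powr s" f]
      by (simp only: cmod_fourier_multiplier_bracket)
    \<comment> \<open>The factor \<open>c\<^sup>2\<close> is split off to match the lower bound on
      the weight sum.\<close>
    also have "\<dots> = ennreal ((C / c)\<^sup>2) * (ennreal (c\<^sup>2) * S)"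
      using c by (simp add: power_divide mult.assoc[symmetric] flip: ennreal_mult)
    also have "\<dots> \<le> ennreal ((C / c)\<^sup>2) * (ennreal (K\<^sup>2) * (data_norm d w 2 (s + ?\<sigma>) (radon d f))\<^sup>2)"
      unfolding S_def by (intro mult_left_mono K(2) f) simp
    also have "\<dots> = (ennreal (C / c * K) * data_norm d w 2 (s + ?\<sigma>) (radon d f))\<^sup>2"
      using c C(1) K(1)
      by (simp add: power_mult_distrib power_divide ennreal_power mult.assoc[symmetric] flip: ennreal_mult)
    finally show "sobolev_norm q s f \<le> ennreal (C / c * K) * data_norm d w 2 (s + ?\<sigma>) (radon d f)"
      by (rule ennreal_power2_le_imp_le)
  qed (use c C K in simp)
qed

theorem proposition4p3:
  fixes w :: "int ^ 'n \<Rightarrow> (rat ^ 'n) set \<Rightarrow> real"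
    and d :: nat and s c\<^sub>w C\<^sub>w :: real
  assumes "2 \<le> CARD('n)" and "1 \<le> d" and "d \<le> CARD('n) - 1"
    and "is_weight d w"
    and "0 < c\<^sub>w" and "0 < C\<^sub>w"
    and "\<And>k. ennreal (c\<^sub>w\<^sup>2) \<le> weight_sum d w k \<and> weight_sum d w k \<le> ennreal (C\<^sub>w\<^sup>2)"
  shows
    "(\<forall>p::real. 1 < p \<and> p \<le> 2 \<longrightarrow>
        (\<exists>C\<^sub>1>0. \<exists>C\<^sub>2>0. \<forall>f::(real ^ 'n \<Rightarrow> complex) \<Rightarrow> complex. f \<in> distributions \<longrightarrow>
           sobolev_norm p s f \<le> ennreal C\<^sub>1 * data_norm d w 2 s (radon d f) \<and>
           ennreal C\<^sub>1 * data_norm d w 2 s (radon d f)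
             \<le> ennreal C\<^sub>2 * data_norm d w p (s + sobolev_exponent TYPE('n) p) (radon d f)))
     \<and> (\<exists>C\<^sub>1>0. \<forall>f::(real ^ 'n \<Rightarrow> complex) \<Rightarrow> complex. f \<in> distributions \<longrightarrow>
           sobolev_norm 1 s f \<le> ennreal C\<^sub>1 * data_norm d w 2 s (radon d f))
     \<and> (\<forall>p::real. 2 \<le> p \<longrightarrow>
        (\<exists>C\<^sub>1>0. \<exists>C\<^sub>2>0. \<forall>f::(real ^ 'n \<Rightarrow> complex) \<Rightarrow> complex. f \<in> distributions \<longrightarrow>
           sobolev_norm p s f
             \<le> ennreal C\<^sub>1 * data_norm d w 2 (s + sobolev_exponent TYPE('n) p) (radon d f) \<and>
           ennreal C\<^sub>1 * data_norm d w 2 (s + sobolev_exponent TYPE('n) p) (radon d f)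
             \<le> ennreal C\<^sub>2 * data_norm d w p (s + sobolev_exponent TYPE('n) p) (radon d f)))"
proof -
  have w: "ennreal (c\<^sub>w\<^sup>2) \<le> weight_sum d w k" for k using assms(7) by blast
  have "sobolev_exponent TYPE('n) 2 = 0" by (simp add: sobolev_exponent_def)
  \<comment> \<open>The constant of the case p = 2 serves as \<open>C\<^sub>1\<close> for every p
    from 1 to 2, by monotonicity of the norms in p.\<close>
  then obtain C where C: "0 < C" "\<And>f :: (real ^ 'n \<Rightarrow> complex) \<Rightarrow> complex. f \<in> distributions \<Longrightarrow>
      sobolev_norm 2 s f \<le> ennreal C * data_norm d w 2 s (radon d f)"
    using radon_stability[OF assms(5) w, of 2 s] by auto
  have low: "sobolev_norm p s f \<le> ennreal C * data_norm d w 2 s (radon d f)"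
    if "f \<in> distributions" "1 \<le> p" "p \<le> 2" for p and f :: "(real ^ 'n \<Rightarrow> complex) \<Rightarrow> complex"
    using order_trans[OF Lp_norm_mono C(2)[OF that(1), unfolded sobolev_norm_def]] that
    by (simp add: sobolev_norm_def)
  show ?thesis
  proof (intro conjI allI impI)
    fix p :: real assume p: "1 < p \<and> p \<le> 2"
    let ?\<sigma> = "sobolev_exponent TYPE('n) p"
    obtain K where K: "0 < K" "\<And>u :: (real ^ 'n \<Rightarrow> complex) \<Rightarrow> complex.
        (sobolev_norm 2 s u)\<^sup>2 \<le> ennreal (K\<^sup>2) * (sobolev_norm p (s + ?\<sigma>) u)\<^sup>2"
      using sobolev_embedding[of p, where 'n = 'n] p by blast
    have "ennreal C * data_norm d w 2 s G \<le> ennreal (C * K) * data_norm d w p (s + ?\<sigma>) G"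
      for G :: "(rat ^ 'n) set \<Rightarrow> (real ^ 'n \<Rightarrow> complex) \<Rightarrow> complex"
      using mult_left_mono[OF data_norm_le[OF K], of "ennreal C" d w G] C(1) K(1)
      by (simp add: ennreal_mult mult.assoc)
    then show "\<exists>C\<^sub>1>0. \<exists>C\<^sub>2>0. \<forall>f::(real ^ 'n \<Rightarrow> complex) \<Rightarrow> complex. f \<in> distributions \<longrightarrow>
        sobolev_norm p s f \<le> ennreal C\<^sub>1 * data_norm d w 2 s (radon d f) \<and>
        ennreal C\<^sub>1 * data_norm d w 2 s (radon d f)
          \<le> ennreal C\<^sub>2 * data_norm d w p (s + ?\<sigma>) (radon d f)"
      using C(1) K(1) p low by (intro exI[of _ C] conjI exI[of _ "C * K"] allI impI) auto
  next
    show "\<exists>C\<^sub>1>0. \<forall>f::(real ^ 'n \<Rightarrow> complex) \<Rightarrow> complex. f \<in> distributions \<longrightarrow>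
        sobolev_norm 1 s f \<le> ennreal C\<^sub>1 * data_norm d w 2 s (radon d f)"
      using C(1) low by (intro exI[of _ C]) auto
  next
    fix p :: real assume p: "2 \<le> p"
    let ?\<sigma> = "sobolev_exponent TYPE('n) p"
    obtain K where K: "0 < K" "\<And>f :: (real ^ 'n \<Rightarrow> complex) \<Rightarrow> complex. f \<in> distributions \<Longrightarrow>
        sobolev_norm p s f \<le> ennreal K * data_norm d w 2 (s + ?\<sigma>) (radon d f)"
      using radon_stability[OF assms(5) w p, of s] by blast
    \<comment> \<open>For p at least 2 the second inequality is an inclusion with constant 1, so
      \<open>C\<^sub>1\<close> and \<open>C\<^sub>2\<close> may coincide.\<close>
    have "(sobolev_norm 2 (s + ?\<sigma>) u)\<^sup>2 \<le> ennreal (1\<^sup>2) * (sobolev_norm p (s + ?\<sigma>) u)\<^sup>2"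
      for u :: "(real ^ 'n \<Rightarrow> complex) \<Rightarrow> complex"
      using p by (simp add: sobolev_norm_def power_mono Lp_norm_mono)
    from data_norm_le[OF zero_less_one this]
    have "data_norm d w 2 (s + ?\<sigma>) G \<le> data_norm d w p (s + ?\<sigma>) G"
      for G :: "(rat ^ 'n) set \<Rightarrow> (real ^ 'n \<Rightarrow> complex) \<Rightarrow> complex"
      by simp
    then show "\<exists>C\<^sub>1>0. \<exists>C\<^sub>2>0. \<forall>f::(real ^ 'n \<Rightarrow> complex) \<Rightarrow> complex. f \<in> distributions \<longrightarrow>
        sobolev_norm p s f \<le> ennreal C\<^sub>1 * data_norm d w 2 (s + ?\<sigma>) (radon d f) \<and>
        ennreal C\<^sub>1 * data_norm d w 2 (s + ?\<sigma>) (radon d f)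
          \<le> ennreal C\<^sub>2 * data_norm d w p (s + ?\<sigma>) (radon d f)"
      using K by (intro exI[of _ K] conjI exI[of _ K] allI impI mult_left_mono) auto
  qed
qed

end
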